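(* Let $p=2n$, $n\ge1$, $d=2p+2$, and let $\mathcal H(B_{\mu(p)},g_{\mu\nu})$ and $\mathcal O(B_{\mu(p)},g_{\mu\nu})$ be smooth scalar functions. For a $(p+1)$-form $F$ and a unit timelike vector $v$ at a point, put $E_{\mu(p)}=F_{\mu_1\dots\mu_p\nu}v^\nu$ and $B_{\mu(p)}=F^*_{\mu_1\dots\mu_p\nu}v^\nu$, and for $\delta v_\mu$ with $v^\mu\delta v_\mu=0$ let $\delta_v\mathcal O$ be the first-order variation of $\mathcal O(B,g)$ under $v\to v+\delta v$ at fixed $F$. Then the following are equivalent: (i) $\mathcal O$ is $v$-independent on the mass shell: whenever $E_{\mu(p)}=H_{\mu(p)}(B)$, one has $\delta_v\mathcal O=0$ for all $\delta v_\mu$ with $v^\mu\delta v_\mu=0$; (ii) $\mathcal O$ is an invariant observable, i.e. $\mathcal O_{[\mu_1\dots\mu_p}H_{\mu_{p+1}\dots\mu_{2p}]}=0$ identically in $B$.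
   Context: The $d$-dimensional metric has signature $(-,+,\dots,+)$; unit timelike means $v^\mu v_\mu=-1$. The dual is $F^{*\,\mu_1\dots\mu_{p+1}}=\frac1{(p+1)!}\boldsymbol\varepsilon^{\mu_1\dots\mu_{p+1}\nu_1\dots\nu_{p+1}}F_{\nu_1\dots\nu_{p+1}}$, with $\boldsymbol\varepsilon$ the Levi-Civita tensor; $(F^* )^*=F$. Square brackets denote antisymmetrization. "Scalar function" of $B_{\mu(p)}$ (a $p$-form with $B_{\mu_1\dots\mu_{p-1}\nu}v^\nu=0$) and $g_{\mu\nu}$ means a function of the scalars obtained by contracting copies of $B$ with the metric. Its derivatives are defined by $\delta_B\mathcal H=\frac1{p!}\delta B^{\mu_1\dots\mu_p}H_{\mu_1\dots\mu_p}$ and $\delta_B\mathcal O=\frac1{p!}\delta B^{\mu_1\dots\mu_p}\mathcal O_{\mu_1\dots\mu_p}$, and are $p$-forms annihilated by contraction with $v$. *)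

theory Defs
  imports "HOL-Analysis.Analysis"
begin

text \<open>
  Tensors at a point of a \<open>CARD('d)\<close>-dimensional spacetime are given by their components: a tensor
  with a finite type \<open>'s\<close> of index slots is a vector in \<open>real ^ ('s \<Rightarrow> 'd)\<close>, whose component at
  \<open>m :: 's \<Rightarrow> 'd\<close> carries the coordinate index \<open>m s\<close> in slot \<open>s\<close>. For \<open>p = CARD('p)\<close>, the slots of a
  \<open>p\<close>-form are \<open>'p\<close> and those of a \<open>(p+1)\<close>-form are \<open>'p option\<close>, where \<open>None\<close> is the last slot
  (the index \<open>\<nu>\<close> in \<open>F\<^bsub>\<mu>\<^sub>1\<dots>\<mu>\<^sub>p\<nu>\<^esub>\<close>).
\<close>

type_synonym ('s, 'd) tensor = "real ^ ('s \<Rightarrow> 'd)"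
type_synonym 'd metric_tensor = "real ^ 'd ^ 'd"

definition lorentzian :: "'d::finite metric_tensor \<Rightarrow> bool" where
  "lorentzian g \<longleftrightarrow> transpose g = g \<and>
     (\<exists>(A :: real ^ 'd ^ 'd) t. invertible A \<and>
        transpose A ** g ** A = (\<chi> i j. if i = j then (if i = t then -1 else 1) else 0))"

definition unit_timelike :: "'d::finite metric_tensor \<Rightarrow> real ^ 'd \<Rightarrow> bool" where
  "unit_timelike g v \<longleftrightarrow> v \<bullet> (g *v v) = -1"

text \<open>Contraction of every index with \<open>M\<close>; it lowers all indices for \<open>M = g\<close>, and raises them for
  the inverse metric.\<close>

definition change_indices :: "'d::finite metric_tensor \<Rightarrow> ('s::finite, 'd) tensor \<Rightarrow> ('s, 'd) tensor" where
  "change_indices M T = (\<chi> m. \<Sum>k\<in>UNIV. (\<Prod>s\<in>UNIV. M $ m s $ k s) * T $ k)"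

abbreviation lower_indices :: "'d::finite metric_tensor \<Rightarrow> ('s::finite, 'd) tensor \<Rightarrow> ('s, 'd) tensor" where
  "lower_indices g \<equiv> change_indices g"

abbreviation raise_indices :: "'d::finite metric_tensor \<Rightarrow> ('s::finite, 'd) tensor \<Rightarrow> ('s, 'd) tensor" where
  "raise_indices g \<equiv> change_indices (matrix_inv g)"

definition antisymmetric :: "('s::finite, 'd::finite) tensor \<Rightarrow> bool" where
  "antisymmetric T \<longleftrightarrow> (\<forall>\<pi>. \<pi> permutes UNIV \<longrightarrow> (\<forall>m. T $ (m \<circ> \<pi>) = of_int (sign \<pi>) * T $ m))"

definition antisymmetrize :: "('s::finite, 'd::finite) tensor \<Rightarrow> ('s, 'd) tensor" where
  "antisymmetrize T =
     (\<chi> m. (\<Sum>\<pi> | \<pi> permutes UNIV. of_int (sign \<pi>) * T $ (m \<circ> \<pi>)) / fact CARD('s))"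

definition tensor_product ::
  "('s::finite, 'd::finite) tensor \<Rightarrow> ('r::finite, 'd) tensor \<Rightarrow> ('s + 'r, 'd) tensor" where
  "tensor_product S T = (\<chi> m. S $ (m \<circ> Inl) * T $ (m \<circ> Inr))"

text \<open>The covariant Levi-Civita tensor. The bijection \<open>e\<close> from slots to coordinates stands for the
  orientation together with the linear order of the slots: \<open>\<epsilon>\<close> is positive when every slot \<open>s\<close>
  carries the index \<open>e s\<close>.\<close>

definition levi_civita :: "'d::finite metric_tensor \<Rightarrow> ('s::finite \<Rightarrow> 'd) \<Rightarrow> ('s, 'd) tensor" where
  "levi_civita g e =
     (\<chi> m. sqrt \<bar>det g\<bar> * (if bij m then of_int (sign (inv e \<circ> m)) else 0))"

text \<open>The dual, with indices lowered. The contracted indices \<open>\<nu>\<close> of \<open>F\<close> occupy the second half of the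
  slots of \<open>\<epsilon>\<close>.\<close>

definition dual ::
  "'d::finite metric_tensor \<Rightarrow> ('r::finite + 'r \<Rightarrow> 'd) \<Rightarrow> ('r, 'd) tensor \<Rightarrow> ('r, 'd) tensor" where
  "dual g e F = lower_indices g
     (\<chi> m. (\<Sum>k\<in>UNIV. raise_indices g (levi_civita g e) $ case_sum m k * F $ k) / fact CARD('r))"

definition contract_last ::
  "('p::finite option, 'd::finite) tensor \<Rightarrow> real ^ 'd \<Rightarrow> ('p, 'd) tensor" where
  "contract_last T v = (\<chi> m. \<Sum>a\<in>UNIV. T $ case_option a m * v $ a)"

definition electric ::
  "('p::finite option, 'd::finite) tensor \<Rightarrow> real ^ 'd \<Rightarrow> ('p, 'd) tensor" where
  "electric F v = contract_last F v"

definition magnetic ::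
  "'d::finite metric_tensor \<Rightarrow> ('p::finite option + 'p option \<Rightarrow> 'd) \<Rightarrow> ('p option, 'd) tensor \<Rightarrow>
     real ^ 'd \<Rightarrow> ('p, 'd) tensor" where
  "magnetic g e F v = contract_last (dual g e F) v"

definition transverse_forms :: "real ^ 'd::finite \<Rightarrow> ('p::finite, 'd) tensor set" where
  "transverse_forms v =
     {B. antisymmetric B \<and> (\<forall>s m. (\<Sum>a\<in>UNIV. B $ m(s := a) * v $ a) = 0)}"

text \<open>Continuous differentiability on a linear subspace \<open>S\<close>; the directions \<open>h\<close> range over \<open>S\<close>
  because only there is the derivative within \<open>S\<close> determined.\<close>

primrec C_k_on :: "nat \<Rightarrow> 'a::real_normed_vector set \<Rightarrow> ('a \<Rightarrow> real) \<Rightarrow> bool" where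
  "C_k_on 0 S f \<longleftrightarrow> continuous_on S f"
| "C_k_on (Suc k) S f \<longleftrightarrow>
     (\<exists>f'. (\<forall>x\<in>S. (f has_derivative f' x) (at x within S)) \<and> (\<forall>h\<in>S. C_k_on k S (\<lambda>x. f' x h)))"

definition smooth_on_subspace :: "'a::real_normed_vector set \<Rightarrow> ('a \<Rightarrow> real) \<Rightarrow> bool" where
  "smooth_on_subspace S f \<longleftrightarrow> (\<forall>k. C_k_on k S f)"

text \<open>The slots of \<open>m\<close> copies of \<open>B\<close> are the pairs in \<open>{..<m} \<times> UNIV\<close>. A complete contraction is
  specified by splitting them into pairs, each listed in \<open>P\<close> in one of its two orders.\<close>

definition complete_pairing :: "nat \<Rightarrow> ((nat \<times> 'p::finite) \<times> (nat \<times> 'p)) set \<Rightarrow> bool" where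
  "complete_pairing m P \<longleftrightarrow> inj_on fst P \<and> inj_on snd P \<and>
     fst ` P \<inter> snd ` P = {} \<and> fst ` P \<union> snd ` P = {..<m} \<times> UNIV"

definition contraction ::
  "'d::finite metric_tensor \<Rightarrow> ('p::finite, 'd) tensor \<Rightarrow> nat \<Rightarrow>
     ((nat \<times> 'p) \<times> (nat \<times> 'p)) set \<Rightarrow> real" where
  "contraction g B m P =
     (\<Sum>k \<in> ({..<m} \<times> UNIV) \<rightarrow>\<^sub>E UNIV.
        (\<Prod>i<m. B $ (\<lambda>s. k (i, s))) * (\<Prod>(a, b)\<in>P. matrix_inv g $ k a $ k b))"

text \<open>Only the values on Lorentzian metrics and on forms transverse to some unit timelike vector
  are relevant; nothing is required of a scalar function elsewhere.\<close>

definition scalar_function :: "('d::finite metric_tensor \<Rightarrow> ('p::finite, 'd) tensor \<Rightarrow> real) \<Rightarrow> bool" where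
  "scalar_function f \<longleftrightarrow>
     (\<exists>\<Phi>. \<forall>g v. lorentzian g \<longrightarrow> unit_timelike g v \<longrightarrow>
        (\<forall>B\<in>transverse_forms v.
           f g B = \<Phi> (\<lambda>m P. if complete_pairing m P then contraction g B m P else 0)))"

definition smooth_scalar_function ::
  "('d::finite metric_tensor \<Rightarrow> ('p::finite, 'd) tensor \<Rightarrow> real) \<Rightarrow> bool" where
  "smooth_scalar_function f \<longleftrightarrow> scalar_function f \<and>
     (\<forall>g v. lorentzian g \<longrightarrow> unit_timelike g v \<longrightarrow> smooth_on_subspace (transverse_forms v) (f g))"

text \<open>The form \<open>H\<^bsub>\<mu>(p)\<^esub>\<close> with \<open>\<delta>H = \<delta>B\<^bsup>\<mu>(p)\<^esup> H\<^bsub>\<mu>(p)\<^esub> / p!\<close> for all variations of \<open>B\<close> among the forms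
  transverse to \<open>v\<close>.\<close>

definition form_derivative ::
  "'d::finite metric_tensor \<Rightarrow> real ^ 'd \<Rightarrow> (('p::finite, 'd) tensor \<Rightarrow> real) \<Rightarrow> ('p, 'd) tensor \<Rightarrow>
     ('p, 'd) tensor" where
  "form_derivative g v f B =
     (THE G. G \<in> transverse_forms v \<and>
        (f has_derivative (\<lambda>\<delta>B. (\<Sum>m\<in>UNIV. raise_indices g \<delta>B $ m * G $ m) / fact CARD('p)))
          (at B within transverse_forms v))"

text \<open>\<open>\<delta>\<^sub>v f\<close> has the value \<open>D\<close>: since \<open>v\<^sub>\<mu> \<delta>v\<^sup>\<mu> = 0\<close>, the vector \<open>v + t \<delta>v\<close> is timelike for small \<open>t\<close>
  and has unit length to first order in \<open>t\<close>. The argument \<open>\<delta>v\<close> has its index down.\<close>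

definition has_v_variation ::
  "'d::finite metric_tensor \<Rightarrow> ('p::finite option + 'p option \<Rightarrow> 'd) \<Rightarrow>
     ('d metric_tensor \<Rightarrow> ('p, 'd) tensor \<Rightarrow> real) \<Rightarrow> ('p option, 'd) tensor \<Rightarrow>
     real ^ 'd \<Rightarrow> real ^ 'd \<Rightarrow> real \<Rightarrow> bool" where
  "has_v_variation g e f F v \<delta>v D \<longleftrightarrow>
     ((\<lambda>t. f g (magnetic g e F (v + t *\<^sub>R (matrix_inv g *v \<delta>v)))) has_real_derivative D) (at 0)"

definition v_independent_on_shell ::
  "'d::finite metric_tensor \<Rightarrow> ('p::finite option + 'p option \<Rightarrow> 'd) \<Rightarrow>
     ('d metric_tensor \<Rightarrow> ('p, 'd) tensor \<Rightarrow> real) \<Rightarrow> ('d metric_tensor \<Rightarrow> ('p, 'd) tensor \<Rightarrow> real) \<Rightarrow> bool" where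
  "v_independent_on_shell g e H f \<longleftrightarrow>
     (\<forall>F v. antisymmetric F \<longrightarrow> unit_timelike g v \<longrightarrow>
        electric F v = form_derivative g v (H g) (magnetic g e F v) \<longrightarrow>
        (\<forall>\<delta>v. v \<bullet> \<delta>v = 0 \<longrightarrow> has_v_variation g e f F v \<delta>v 0))"

definition invariant_observable ::
  "'d::finite metric_tensor \<Rightarrow> ('d metric_tensor \<Rightarrow> ('p::finite, 'd) tensor \<Rightarrow> real) \<Rightarrow>
     ('d metric_tensor \<Rightarrow> ('p, 'd) tensor \<Rightarrow> real) \<Rightarrow> bool" where
  "invariant_observable g H f \<longleftrightarrow>
     (\<forall>v. unit_timelike g v \<longrightarrow> (\<forall>B\<in>transverse_forms v.
        antisymmetrize
          (tensor_product (form_derivative g v (f g) B) (form_derivative g v (H g) B)) = 0))"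

end

theory Submission
  imports Defs
begin

text \<open>
  For fixed \<open>F\<close>, the variation \<open>v \<rightarrow> v + \<delta>v\<close> changes \<open>B\<close> by the contraction of the dual of \<open>F\<close> with \<open>\<delta>v\<close>,
  up to a boost, under which the scalar \<open>\<O>\<close> is invariant. So \<open>\<delta>\<^sub>v\<O>\<close> is a multiple of \<open>\<epsilon>\<close> contracted with
  the derivative of \<open>\<O>\<close>, with \<open>\<delta>v\<close> and with \<open>F\<close>. The first two are orthogonal to \<open>v\<close>, so one slot
  of \<open>F\<close> must carry \<open>v\<close>, and only the electric part survives: the Schouten identity (antisymmetrizing over
  more than \<open>d\<close> indices gives zero) turns \<open>\<delta>\<^sub>v\<O>\<close> into \<open>\<epsilon>\<close> contracted with \<open>\<delta>\<O>/\<delta>B\<close>, \<open>\<delta>v\<close>, \<open>E\<close> and \<open>v\<close>.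
  This vanishes for all \<open>\<delta>v\<close> iff the wedge product of \<open>\<delta>\<O>/\<delta>B\<close> and \<open>E\<close> does, and \<open>E = \<delta>\<H>/\<delta>B\<close> on shell.
  Conversely, every transverse pair \<open>(E, B)\<close> comes from some \<open>F\<close>: the map \<open>B \<mapsto> \<close> magnetic part of \<open>*(B \<and> v)\<close>
  is injective on the transverse forms, which carry a positive definite product, hence surjective.
\<close>

subsection \<open>Change of indices, antisymmetry and transversality\<close>

text \<open>Three points shape the proof. (1) A smooth scalar function is differentiable only within
  one space \<open>transverse_forms v\<close>, while the magnetic part seen by
  \<open>v + t w\<close> leaves that space as t varies; hence the curve is carried back by
  isometries before differentiating. Moreover \<open>form_derivative\<close> is a definite
  description, so a transverse gradient must first be shown to exist and to be unique. (2) The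
  indefinite metric is tamed by writing its inverse as \<open>A ** transpose A\<close> minus twice
  the square of v, which is possible for every unit timelike v. Transverse tensors do not see the
  rank-one term, so their products are Euclidean in a suitable frame. The gradient and the
  construction of F both rest on this. (3) Contractions with epsilon are inner products of component
  arrays, the other factor having upper indices and being transverse to the covector
  \<open>g *v v\<close>. The dimension enters as a slot count: of the 2p + 2 slots, two p-forms fill
  2p and the vectors of the observer and of its variation fill the other two. The factors -1, p + 1
  and factorials picked up on the way are nonzero, and only vanishing is compared.\<close>

lemma sum_fun_slot:
  fixes h :: "('s::finite \<Rightarrow> 'd::finite) \<Rightarrow> 'd \<Rightarrow> real"
  shows "(\<Sum>k\<in>UNIV. \<Sum>a\<in>UNIV. h (k(s := a)) (k s)) = (\<Sum>k\<in>UNIV. \<Sum>a\<in>UNIV. h k a)"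
proof -
  have "(\<Sum>(k, a)\<in>UNIV. h (k(s := a)) (k s)) = (\<Sum>(k, a)\<in>UNIV. h k a)"
    by (rule sum.reindex_bij_witness[where i = "\<lambda>(k, a). (k(s := a), k s)"
          and j = "\<lambda>(k, a). (k(s := a), k s)"]) auto
  then show ?thesis
    by (simp add: sum.cartesian_product)
qed

text \<open>Refilling slot \<open>s\<close> in all ways meets every index map
  \<open>CARD('d)\<close> times, so a multiple of the total is a sum of vanishing fibre sums. In
  this form one contraction with a transverse vector kills a sum over all index maps.\<close>

lemma sum_fun_slot_zero:
  fixes f :: "('s::finite \<Rightarrow> 'd::finite) \<Rightarrow> real"
  assumes "\<And>k. (\<Sum>a\<in>UNIV. f (k(s := a))) = 0"
  shows "(\<Sum>k\<in>UNIV. f k) = 0"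
proof -
  have "real CARD('d) * (\<Sum>k\<in>UNIV. f k) = (\<Sum>k\<in>UNIV. \<Sum>a\<in>(UNIV :: 'd set). f k)"
    by (simp add: sum_distrib_left)
  also have "\<dots> = (\<Sum>k\<in>UNIV. \<Sum>a\<in>UNIV. f (k(s := a)))"
    using sum_fun_slot[of "\<lambda>k a. f k" s] by simp
  finally show ?thesis
    using assms by simp
qed

section \<open>Index maps on composite slot types\<close>

lemma sum_fun_eta: "case_sum (k \<circ> Inl) (k \<circ> Inr) = k"
  by (auto simp: fun_eq_iff split: sum.split)

lemma option_fun_eta: "case_option (k None) (k \<circ> Some) = k"
  by (auto simp: fun_eq_iff split: option.split)

lemma case_option_o_Some: "case_option a m \<circ> Some = m"
  by auto

lemma sum_fun_sum:
  fixes f :: "('r::finite + 's::finite \<Rightarrow> 'd::finite) \<Rightarrow> real"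
  shows "(\<Sum>k\<in>UNIV. f k) = (\<Sum>i\<in>UNIV. \<Sum>j\<in>UNIV. f (case_sum i j))"
proof -
  have "(\<Sum>k\<in>UNIV. f k) = (\<Sum>(i, j)\<in>UNIV. f (case_sum i j))"
    by (rule sum.reindex_bij_witness[where j = "\<lambda>k. (k \<circ> Inl, k \<circ> Inr)"
          and i = "\<lambda>(i, j). case_sum i j"]) (auto simp: sum_fun_eta case_sum_o_inj)
  then show ?thesis
    by (simp add: sum.cartesian_product)
qed

lemma sum_fun_option:
  fixes f :: "('s::finite option \<Rightarrow> 'd::finite) \<Rightarrow> real"
  shows "(\<Sum>k\<in>UNIV. f k) = (\<Sum>m\<in>UNIV. \<Sum>a\<in>UNIV. f (case_option a m))"
proof -
  have "(\<Sum>k\<in>UNIV. f k) = (\<Sum>(m, a)\<in>UNIV. f (case_option a m))"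
    by (rule sum.reindex_bij_witness[where j = "\<lambda>k. (k \<circ> Some, k None)"
          and i = "\<lambda>(m, a). case_option a m"]) (auto simp: option_fun_eta case_option_o_Some)
  then show ?thesis
    by (simp add: sum.cartesian_product)
qed

lemma prod_UNIV_sum:
  fixes f :: "'r::finite + 's::finite \<Rightarrow> real"
  shows "(\<Prod>s\<in>UNIV. f s) = (\<Prod>s\<in>UNIV. f (Inl s)) * (\<Prod>s\<in>UNIV. f (Inr s))"
  by (simp add: UNIV_Plus_UNIV[symmetric] prod.Plus comp_def del: UNIV_Plus_UNIV)

lemma prod_UNIV_option:
  fixes f :: "'s::finite option \<Rightarrow> real"
  shows "(\<Prod>s\<in>UNIV. f s) = f None * (\<Prod>s\<in>UNIV. f (Some s))"
  by (simp add: UNIV_option_conv prod.reindex)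

lemma prod_sum_UNIV:
  fixes f :: "'s::finite \<Rightarrow> 'd::finite \<Rightarrow> real"
  shows "(\<Prod>s\<in>UNIV. \<Sum>a\<in>UNIV. f s a) = (\<Sum>k\<in>UNIV. \<Prod>s\<in>UNIV. f s (k s))"
  using prod_sum_PiE[of "UNIV :: 's set" "\<lambda>_. UNIV :: 'd set" f] by (simp add: PiE_UNIV_domain)

section \<open>Algebra of changing all indices by a matrix\<close>

lemma change_indices_nth:
  "change_indices M T $ m = (\<Sum>k\<in>UNIV. (\<Prod>s\<in>UNIV. M $ m s $ k s) * T $ k)"
  by (simp add: change_indices_def)

lemma change_indices_compose:
  fixes T :: "('s::finite, 'd::finite) tensor"
  shows "change_indices M (change_indices N T) = change_indices (M ** N) T"
proof (simp add: vec_eq_iff change_indices_nth, rule allI)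
  fix m :: "'s \<Rightarrow> 'd"
  have "(\<Sum>j\<in>UNIV. (\<Prod>s\<in>UNIV. M $ m s $ j s) * (\<Sum>k\<in>UNIV. (\<Prod>s\<in>UNIV. N $ j s $ k s) * T $ k))
    = (\<Sum>j\<in>UNIV. \<Sum>k\<in>UNIV. (\<Prod>s\<in>UNIV. M $ m s $ j s * N $ j s $ k s) * T $ k)"
    by (simp add: sum_distrib_left prod.distrib mult.assoc)
  also have "\<dots> = (\<Sum>k\<in>UNIV. (\<Sum>j\<in>UNIV. \<Prod>s\<in>UNIV. M $ m s $ j s * N $ j s $ k s) * T $ k)"
    by (subst sum.swap) (simp add: sum_distrib_right)
  also have "\<dots> = (\<Sum>k\<in>UNIV. (\<Prod>s\<in>UNIV. (M ** N) $ m s $ k s) * T $ k)"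
    by (simp add: matrix_matrix_mult_def prod_sum_UNIV)
  finally show "(\<Sum>j\<in>UNIV. (\<Prod>s\<in>UNIV. M $ m s $ j s) * (\<Sum>k\<in>UNIV. (\<Prod>s\<in>UNIV. N $ j s $ k s) * T $ k))
    = (\<Sum>k\<in>UNIV. (\<Prod>s\<in>UNIV. (M ** N) $ m s $ k s) * T $ k)" .
qed

lemma change_indices_mat_1 [simp]:
  fixes T :: "('s::finite, 'd::finite) tensor"
  shows "change_indices (mat 1) T = T"
proof (simp add: vec_eq_iff change_indices_nth, rule allI)
  fix m :: "'s \<Rightarrow> 'd"
  have "(\<Prod>s\<in>UNIV. (mat 1 :: 'd metric_tensor) $ m s $ k s) = (if k = m then 1 else 0)" for k
  proof (cases "k = m")
    case False
    then obtain s where "m s \<noteq> k s"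
      using ext[of m k] by blast
    then have "(mat 1 :: 'd metric_tensor) $ m s $ k s = 0"
      by (simp add: mat_def)
    then show ?thesis
      using False by (auto intro!: prod_zero)
  qed (simp add: mat_def)
  then show "(\<Sum>k\<in>UNIV. (\<Prod>s\<in>UNIV. (mat 1 :: 'd metric_tensor) $ m s $ k s) * T $ k) = T $ m"
    by (simp add: if_distrib[of "\<lambda>x. x * _"] cong: if_cong)
qed

lemma linear_change_indices: "linear (change_indices M)"
proof (rule linearI)
  show "change_indices M (S + T) = change_indices M S + change_indices M T" for S T
    by (simp add: vec_eq_iff change_indices_nth distrib_left sum.distrib)
  show "change_indices M (r *\<^sub>R T) = r *\<^sub>R change_indices M T" for r T
    by (simp add: vec_eq_iff change_indices_nth sum_distrib_left mult.left_commute)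
qed

lemmas change_indices_add = linear_add[OF linear_change_indices]
  and change_indices_scaleR = linear_scale[OF linear_change_indices]
  and change_indices_0 [simp] = linear_0[OF linear_change_indices]

lemma inner_tensor: "(X :: ('s::finite, 'd::finite) tensor) \<bullet> Y = (\<Sum>m\<in>UNIV. X $ m * Y $ m)"
  by (simp add: inner_vec_def)

lemma change_indices_adjoint:
  "change_indices M X \<bullet> Y = X \<bullet> change_indices (transpose M) Y"
proof -
  have "change_indices M X \<bullet> Y = (\<Sum>m\<in>UNIV. \<Sum>k\<in>UNIV. (\<Prod>s\<in>UNIV. M $ m s $ k s) * X $ k * Y $ m)"
    by (simp add: inner_tensor change_indices_nth sum_distrib_right)
  also have "\<dots> = (\<Sum>k\<in>UNIV. \<Sum>m\<in>UNIV. (\<Prod>s\<in>UNIV. M $ m s $ k s) * X $ k * Y $ m)"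
    by (rule sum.swap)
  also have "\<dots> = X \<bullet> change_indices (transpose M) Y"
    by (simp add: inner_tensor change_indices_nth sum_distrib_left transpose_def ac_simps)
  finally show ?thesis .
qed

lemma change_indices_tensor_product:
  "change_indices M (tensor_product S T) = tensor_product (change_indices M S) (change_indices M T)"
  by (simp add: vec_eq_iff change_indices_nth tensor_product_def sum_fun_sum prod_UNIV_sum comp_def
      sum_product ac_simps)

section \<open>Permutations of slots and antisymmetry\<close>

lemma sum_comp_bij:
  fixes f :: "('s::finite \<Rightarrow> 'd::finite) \<Rightarrow> real"
  assumes "bij \<pi>"
  shows "(\<Sum>k\<in>UNIV. f (k \<circ> \<pi>)) = (\<Sum>k\<in>UNIV. f k)"
  by (rule sum.reindex_bij_witness[where j = "\<lambda>k. k \<circ> \<pi>" and i = "\<lambda>k. k \<circ> inv \<pi>"])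
    (use assms in \<open>simp_all add: fun_eq_iff bij_is_inj bij_is_surj surj_f_inv_f\<close>)

lemma change_indices_permute:
  assumes "bij \<pi>"
  shows "change_indices M T $ (m \<circ> \<pi>) = change_indices M (\<chi> k. T $ (k \<circ> \<pi>)) $ m"
proof -
  have "(\<Prod>s\<in>UNIV. M $ m (\<pi> s) $ k (\<pi> s)) = (\<Prod>s\<in>UNIV. M $ m s $ k s)" for k
    using prod.reindex_bij_betw[OF assms, of "\<lambda>s. M $ m s $ k s"] by simp
  then show ?thesis
    using sum_comp_bij[OF assms, of "\<lambda>k. (\<Prod>s\<in>UNIV. M $ m (\<pi> s) $ k s) * T $ k"]
    by (simp add: change_indices_nth comp_def)
qed

text \<open>Antisymmetry only needs to be checked on transpositions, which avoids signs of permutations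
  of composite slot types.\<close>

lemma antisymmetric_iff_swap:
  fixes T :: "('s::finite, 'd::finite) tensor"
  shows
  "antisymmetric T \<longleftrightarrow> (\<forall>a b m. a \<noteq> b \<longrightarrow> T $ (m \<circ> Transposition.transpose a b) = - T $ m)"
proof
  assume T: "antisymmetric T"
  show "\<forall>a b m. a \<noteq> b \<longrightarrow> T $ (m \<circ> Transposition.transpose a b) = - T $ m"
  proof (intro allI impI)
    fix a b :: 's and m :: "'s \<Rightarrow> 'd"
    assume "a \<noteq> b"
    moreover have "Transposition.transpose a b permutes UNIV"
      by (simp add: permutes_swap_id)
    ultimately have "T $ (m \<circ> Transposition.transpose a b)
      = of_int (sign (Transposition.transpose a b)) * T $ m"
      using T unfolding antisymmetric_def by blast
    then show "T $ (m \<circ> Transposition.transpose a b) = - T $ m"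
      using \<open>a \<noteq> b\<close> by (simp add: sign_swap_id)
  qed
next
  assume transp: "\<forall>a b m. a \<noteq> b \<longrightarrow> T $ (m \<circ> Transposition.transpose a b) = - T $ m"
  show "antisymmetric T"
    unfolding antisymmetric_def
  proof (intro allI impI)
    fix \<pi> :: "'s \<Rightarrow> 's" and m :: "'s \<Rightarrow> 'd"
    assume "\<pi> permutes UNIV"
    with finite[of UNIV] show "T $ (m \<circ> \<pi>) = of_int (sign \<pi>) * T $ m"
    proof (induction arbitrary: m rule: permutes_rev_induct)
      case (swap a b p)
      then have "permutation p"
        using permutes_imp_permutation[OF finite[of UNIV]] by simp
      then have "sign (p \<circ> Transposition.transpose a b) = - sign p"
        using \<open>a \<noteq> b\<close> sign_compose[OF _ permutation_swap_id, of p a b] by (simp add: sign_swap_id)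
      moreover have "T $ (m \<circ> (p \<circ> Transposition.transpose a b)) = - T $ (m \<circ> p)"
        using transp \<open>a \<noteq> b\<close> unfolding comp_assoc[symmetric] by blast
      ultimately show ?case
        by (simp only: swap.IH of_int_minus mult_minus_left)
    qed simp
  qed
qed

lemma antisymmetric_swap:
  "antisymmetric T \<Longrightarrow> a \<noteq> b \<Longrightarrow> T $ (m \<circ> Transposition.transpose a b) = - T $ m"
  by (simp add: antisymmetric_iff_swap)

lemma antisymmetric_swap_upd:
  assumes "antisymmetric T" "s \<noteq> s'"
  shows "T $ (m(s := a, s' := b)) = - T $ (m(s := b, s' := a))"
proof -
  have "m(s := a, s' := b) = m(s := b, s' := a) \<circ> Transposition.transpose s s'"
    using assms(2) by (auto simp: fun_eq_iff Transposition.transpose_def)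
  then show ?thesis
    using antisymmetric_swap[OF assms, of "m(s := b, s' := a)"] by simp
qed

lemma antisymmetric_eq_0:
  assumes "antisymmetric T" "\<not> inj m"
  shows "T $ m = 0"
proof -
  obtain a b where ab: "a \<noteq> b" "m a = m b"
    using assms(2) by (auto simp: inj_def)
  have "m \<circ> Transposition.transpose a b = m"
    using ab by (auto simp: fun_eq_iff Transposition.transpose_def)
  then show ?thesis
    using antisymmetric_swap[OF assms(1) ab(1), of m] by simp
qed

lemma antisymmetric_change_indices:
  fixes T :: "('s::finite, 'd::finite) tensor"
  assumes "antisymmetric T"
  shows "antisymmetric (change_indices M T)"
  unfolding antisymmetric_iff_swap
proof (intro allI impI)
  fix a b :: 's and m :: "'s \<Rightarrow> 'd"
  assume ab: "a \<noteq> b"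
  have "(\<chi> k. T $ (k \<circ> Transposition.transpose a b)) = (- 1) *\<^sub>R T"
    using antisymmetric_swap[OF assms ab] by (simp add: vec_eq_iff)
  then have "change_indices M T $ (m \<circ> Transposition.transpose a b) = change_indices M ((- 1) *\<^sub>R T) $ m"
    using change_indices_permute[of "Transposition.transpose a b" M T m] by simp
  also have "\<dots> = - change_indices M T $ m"
    by (simp only: change_indices_scaleR vector_scaleR_component) simp
  finally show "change_indices M T $ (m \<circ> Transposition.transpose a b) = - change_indices M T $ m" .
qed

lemma antisymmetric_sum_contract:
  fixes T :: "('s::finite, 'd::finite) tensor"
  assumes "antisymmetric T" "s \<noteq> s'"
  shows "(\<Sum>a\<in>UNIV. \<Sum>b\<in>UNIV. T $ (m(s := a, s' := b)) * x $ a * x $ b) = 0"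
proof -
  define f where "f a b = T $ (m(s := a, s' := b)) * x $ a * x $ b" for a b
  have f: "f a b = - f b a" for a b
    using antisymmetric_swap_upd[OF assms, of m a b] by (simp add: f_def)
  have "(\<Sum>a\<in>UNIV. \<Sum>b\<in>UNIV. f a b) = (\<Sum>a\<in>UNIV. \<Sum>b\<in>UNIV. - f b a)"
    by (rule sum.cong[OF refl], rule sum.cong[OF refl], rule f)
  also have "\<dots> = - (\<Sum>a\<in>UNIV. \<Sum>b\<in>UNIV. f a b)"
    by (subst sum.swap) (simp add: sum_negf)
  finally show ?thesis
    by (simp add: f_def)
qed

text \<open>Antisymmetry is left out so that the notion also covers tensor products; for tensors
  with upper indices the covector \<open>g *v v\<close> takes the place of \<open>v\<close>.\<close>

definition transverse :: "real ^ 'd::finite \<Rightarrow> ('s::finite, 'd) tensor \<Rightarrow> bool" where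
  "transverse v X \<longleftrightarrow> (\<forall>s m. (\<Sum>a\<in>UNIV. X $ m(s := a) * v $ a) = 0)"

lemma transverseD: "transverse v X \<Longrightarrow> (\<Sum>a\<in>UNIV. X $ m(s := a) * v $ a) = 0"
  by (simp add: transverse_def)

lemma transverse_forms_iff: "B \<in> transverse_forms v \<longleftrightarrow> antisymmetric B \<and> transverse v B"
  by (simp add: transverse_forms_def transverse_def)

text \<open>Contracting slot \<open>s\<close> of the changed tensor with \<open>v\<close> amounts to
  contracting slot \<open>s\<close> of \<open>X\<close> with \<open>transpose M *v v\<close>; the
  matrix factors of the other slots are constant in that sum.\<close>

lemma transverse_change_indices:
  fixes X :: "('s::finite, 'd::finite) tensor"
  assumes "transverse (transpose M *v v) X"
  shows "transverse v (change_indices M X)"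
  unfolding transverse_def
proof (intro allI)
  fix s :: 's and m :: "'s \<Rightarrow> 'd"
  let ?x = "transpose M *v v"
  have x: "?x $ b = (\<Sum>a\<in>UNIV. M $ a $ b * v $ a)" for b
    by (simp add: matrix_vector_mult_def transpose_def)
  let ?P = "\<lambda>k. \<Prod>s'\<in>UNIV - {s}. M $ m s' $ k s'"
  have "(\<Prod>s'\<in>UNIV. M $ (m(s := a)) s' $ k s') = M $ a $ k s * ?P k" for a k
    by (subst prod.remove[of _ s]) (auto intro!: prod.cong)
  then have "(\<Sum>a\<in>UNIV. change_indices M X $ m(s := a) * v $ a)
    = (\<Sum>a\<in>UNIV. \<Sum>k\<in>UNIV. M $ a $ k s * ?P k * X $ k * v $ a)"
    by (simp add: change_indices_nth sum_distrib_right)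
  also have "\<dots> = (\<Sum>k\<in>UNIV. ?x $ k s * ?P k * X $ k)"
    unfolding x by (subst sum.swap) (simp add: sum_distrib_left sum_distrib_right ac_simps)
  also have "\<dots> = 0"
  proof (rule sum_fun_slot_zero[where s = s])
    fix k
    have "?P (k(s := b)) = ?P k" for b
      by (auto intro!: prod.cong)
    then have "(\<Sum>b\<in>UNIV. ?x $ (k(s := b)) s * ?P (k(s := b)) * X $ k(s := b))
      = ?P k * (\<Sum>b\<in>UNIV. X $ k(s := b) * ?x $ b)"
      by (simp add: sum_distrib_left ac_simps)
    then show "(\<Sum>b\<in>UNIV. ?x $ (k(s := b)) s * ?P (k(s := b)) * X $ k(s := b)) = 0"
      using transverseD[OF assms] by simp
  qed
  finally show "(\<Sum>a\<in>UNIV. change_indices M X $ m(s := a) * v $ a) = 0" .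
qed

text \<open>The slots are changed one at a time; \<open>A\<close> is the set of slots changed so far.\<close>

lemma change_indices_add_transverse:
  fixes X :: "('s::finite, 'd::finite) tensor"
  assumes X: "transverse v X"
  shows "change_indices (M + (\<chi> i j. w $ i * v $ j)) X = change_indices M X"
proof (simp add: vec_eq_iff change_indices_nth, rule allI)
  fix m :: "'s \<Rightarrow> 'd"
  let ?f = "\<lambda>A k. (\<Prod>s\<in>UNIV. M $ m s $ k s + (if s \<in> A then w $ m s * v $ k s else 0)) * X $ k"
  have "(\<Sum>k\<in>UNIV. ?f A k) = (\<Sum>k\<in>UNIV. ?f {} k)" for A :: "'s set"
    using finite[of A]
  proof (induction A rule: finite_induct)
    case (insert s A)
    let ?P = "\<lambda>k. \<Prod>s'\<in>UNIV - {s}. M $ m s' $ k s' + (if s' \<in> A then w $ m s' * v $ k s' else 0)"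
    \<comment> \<open>Only the factor of slot \<open>s\<close> changes; expanding it splits off a
      term in which that slot of \<open>X\<close> meets \<open>v\<close>.\<close>
    have "?f (insert s A) k = ?f A k + w $ m s * v $ k s * ?P k * X $ k" for k
    proof -
      have "(\<Prod>s'\<in>UNIV - {s}. M $ m s' $ k s' + (if s' \<in> insert s A then w $ m s' * v $ k s' else 0)) = ?P k"
        by (auto intro!: prod.cong)
      then show ?thesis
        using insert.hyps
        by (simp add: prod.remove[of UNIV s] algebra_simps)
    qed
    moreover have "(\<Sum>k\<in>UNIV. w $ m s * v $ k s * ?P k * X $ k) = 0"
    proof (rule sum_fun_slot_zero[where s = s])
      fix k
      have "?P (k(s := b)) = ?P k" for b
        by (intro prod.cong) auto
      then have "(\<Sum>b\<in>UNIV. w $ m s * v $ (k(s := b)) s * ?P (k(s := b)) * X $ k(s := b))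
        = w $ m s * ?P k * (\<Sum>b\<in>UNIV. X $ k(s := b) * v $ b)"
        by (simp add: sum_distrib_left sum_distrib_right ac_simps)
      then show "(\<Sum>b\<in>UNIV. w $ m s * v $ (k(s := b)) s * ?P (k(s := b)) * X $ k(s := b)) = 0"
        using transverseD[OF X] by simp
    qed
    ultimately show ?case
      using insert.IH by (simp add: sum.distrib)
  qed simp
  from this[of UNIV] show "(\<Sum>k\<in>UNIV. (\<Prod>s\<in>UNIV. M $ m s $ k s + w $ m s * v $ k s) * X $ k)
    = (\<Sum>k\<in>UNIV. (\<Prod>s\<in>UNIV. M $ m s $ k s) * X $ k)"
    by simp
qed

subsection \<open>Volume tensors and the Schouten identity\<close>

text \<open>The features of \<open>levi_civita\<close> on which the contractions depend, freed of
  orientation and density. Equal cardinalities make every injective index map bijective.\<close>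

definition volume_tensor :: "('s::finite, 'd::finite) tensor \<Rightarrow> bool" where
  "volume_tensor N \<longleftrightarrow> antisymmetric N \<and> (\<forall>m. N $ m \<noteq> 0 \<longleftrightarrow> bij m) \<and> CARD('s) = CARD('d)"

lemma volume_tensor_levi_civita:
  fixes e :: "'s::finite \<Rightarrow> 'd::finite"
  assumes "bij e" "det g \<noteq> 0"
  shows "volume_tensor (levi_civita g e)"
proof -
  have "levi_civita g e $ (m \<circ> \<pi>) = of_int (sign \<pi>) * levi_civita g e $ m"
    if \<pi>: "\<pi> permutes UNIV" for \<pi> and m :: "'s \<Rightarrow> 'd"
  proof (cases "bij m")
    case True
    have "permutation (inv e \<circ> m)"
      using True assms(1) by (simp add: permutation bij_comp bij_imp_bij_inv)
    moreover have "permutation \<pi>"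
      using permutes_imp_permutation[OF finite[of UNIV] \<pi>] .
    ultimately have "sign (inv e \<circ> (m \<circ> \<pi>)) = sign (inv e \<circ> m) * sign \<pi>"
      by (simp add: sign_compose flip: comp_assoc)
    moreover have "bij (m \<circ> \<pi>)"
      using True \<pi> bij_comp permutes_bij by blast
    ultimately show ?thesis
      using True by (simp add: levi_civita_def)
  next
    case False
    have "\<not> bij (m \<circ> \<pi>)"
      using False \<pi> bij_betw_comp_iff[OF permutes_imp_bij[OF \<pi>], of m UNIV] by blast
    then show ?thesis
      using False by (simp add: levi_civita_def)
  qed
  moreover have "levi_civita g e $ m \<noteq> 0 \<longleftrightarrow> bij m" for m
    using assms(2) by (simp add: levi_civita_def sign_def)
  ultimately show ?thesis
    using bij_betw_same_card[OF assms(1)] by (simp add: volume_tensor_def antisymmetric_def)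
qed

lemma volume_tensor_not_inj: "volume_tensor N \<Longrightarrow> \<not> inj m \<Longrightarrow> N $ m = 0"
  by (meson antisymmetric_eq_0 volume_tensor_def)

lemma volume_tensor_swap_upd:
  "volume_tensor N \<Longrightarrow> s \<noteq> s' \<Longrightarrow> N $ (m(s := a, s' := b)) = - N $ (m(s := b, s' := a))"
  by (meson antisymmetric_swap_upd volume_tensor_def)

text \<open>If \<open>m\<close> is injective, it takes the value \<open>b\<close> at exactly one
  slot, and putting \<open>b\<close> anywhere else creates a repetition. If \<open>m\<close> agrees
  on two slots, only a replacement at one of these can remove the repetition, and the two results
  differ by a swap, so they cancel.\<close>

lemma schouten:
  fixes N :: "('s::finite, 'd::finite) tensor"
  assumes N: "volume_tensor N"
  shows "\<alpha> $ b * N $ m = (\<Sum>s\<in>UNIV. \<alpha> $ (m s) * N $ (m(s := b)))"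
proof (cases "inj m")
  case True
  then have "surj m"
    using N by (metis card_eq_UNIV_imp_eq_UNIV card_image finite volume_tensor_def)
  then obtain s0 where s0: "m s0 = b"
    by (metis surjD)
  have "N $ (m(s := b)) = 0" if "s \<noteq> s0" for s
  proof -
    have "(m(s := b)) s = (m(s := b)) s0"
      using s0 that by simp
    then have "\<not> inj (m(s := b))"
      using that by (meson injD)
    then show ?thesis
      by (rule volume_tensor_not_inj[OF N])
  qed
  then have "(\<Sum>s\<in>UNIV. \<alpha> $ (m s) * N $ (m(s := b))) = (\<Sum>s\<in>{s0}. \<alpha> $ (m s) * N $ (m(s := b)))"
    by (intro sum.mono_neutral_right) auto
  then show ?thesis
    using s0 by (simp add: fun_upd_idem)
next
  case False
  then obtain s1 s2 where s12: "s1 \<noteq> s2" "m s1 = m s2"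
    by (auto simp: inj_def)
  have "N $ (m(s := b)) = 0" if "s \<notin> {s1, s2}" for s
  proof -
    have "(m(s := b)) s1 = (m(s := b)) s2"
      using s12 that by auto
    then have "\<not> inj (m(s := b))"
      using s12(1) by (meson injD)
    then show ?thesis
      by (rule volume_tensor_not_inj[OF N])
  qed
  then have "(\<Sum>s\<in>UNIV. \<alpha> $ (m s) * N $ (m(s := b))) = (\<Sum>s\<in>{s1, s2}. \<alpha> $ (m s) * N $ (m(s := b)))"
    by (intro sum.mono_neutral_right) auto
  also have "\<dots> = \<alpha> $ (m s1) * (N $ (m(s1 := b)) + N $ (m(s2 := b)))"
    using s12 by (simp add: algebra_simps)
  also have "N $ (m(s1 := b)) = - N $ (m(s2 := b))"
  proof -
    have "m(s1 := b) = m(s1 := b, s2 := m s1)"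
      using s12 by (simp add: fun_eq_iff)
    then show ?thesis
      using volume_tensor_swap_upd[OF N s12(1), of m b "m s1"] by simp
  qed
  finally have "(\<Sum>s\<in>UNIV. \<alpha> $ (m s) * N $ (m(s := b))) = 0"
    by (simp only: add.left_inverse mult_zero_right)
  then show ?thesis
    using volume_tensor_not_inj[OF N False] by (simp only: mult_zero_right)
qed

text \<open>The identity is contracted with \<open>v\<close> in the free index and with
  \<open>T\<close> in the slots of \<open>N\<close>. By \<open>sum_fun_slot\<close> the replaced
  slot moves from \<open>N\<close> to \<open>T\<close>, where slot \<open>s\<close> is fed with
  \<open>\<alpha>\<close> and refilled by \<open>v\<close>.\<close>

lemma schouten_contract:
  fixes N T :: "('s::finite, 'd::finite) tensor"
  assumes N: "volume_tensor N"
  shows "(\<alpha> \<bullet> v) * (N \<bullet> T)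
    = (\<Sum>s\<in>UNIV. N \<bullet> (\<chi> m. v $ m s * (\<Sum>a\<in>UNIV. \<alpha> $ a * T $ m(s := a))))"
proof -
  have "(\<alpha> \<bullet> v) * (N \<bullet> T) = (\<Sum>m\<in>UNIV. \<Sum>b\<in>UNIV. v $ b * T $ m * (\<alpha> $ b * N $ m))"
    by (simp add: inner_vec_def sum_distrib_left sum_distrib_right ac_simps)
  also have "\<dots> = (\<Sum>m\<in>UNIV. \<Sum>b\<in>UNIV. \<Sum>s\<in>UNIV. v $ b * T $ m * (\<alpha> $ (m s) * N $ (m(s := b))))"
    by (rule sum.cong[OF refl], rule sum.cong[OF refl], subst schouten[OF N], rule sum_distrib_left)
  also have "\<dots> = (\<Sum>m\<in>UNIV. \<Sum>s\<in>UNIV. \<Sum>b\<in>UNIV. v $ b * T $ m * (\<alpha> $ (m s) * N $ (m(s := b))))"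
    by (rule sum.cong[OF refl], rule sum.swap)
  also have "\<dots> = (\<Sum>s\<in>UNIV. \<Sum>m\<in>UNIV. \<Sum>b\<in>UNIV. v $ b * T $ m * (\<alpha> $ (m s) * N $ (m(s := b))))"
    by (rule sum.swap)
  also have "\<dots> = (\<Sum>s\<in>UNIV. N \<bullet> (\<chi> m. v $ m s * (\<Sum>a\<in>UNIV. \<alpha> $ a * T $ m(s := a))))"
  proof (rule sum.cong[OF refl])
    fix s
    show "(\<Sum>m\<in>UNIV. \<Sum>b\<in>UNIV. v $ b * T $ m * (\<alpha> $ (m s) * N $ (m(s := b))))
      = N \<bullet> (\<chi> m. v $ m s * (\<Sum>a\<in>UNIV. \<alpha> $ a * T $ m(s := a)))"
      using sum_fun_slot[of "\<lambda>k a. N $ k * (v $ k s * (\<alpha> $ a * T $ k(s := a)))" s]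
      by (simp add: inner_vec_def sum_distrib_left mult.commute mult.left_commute)
  qed
  finally show ?thesis .
qed

lemma exists_bij_extension:
  fixes \<iota> :: "'r::finite \<Rightarrow> 's::finite" and j :: "'r \<Rightarrow> 'd::finite"
  assumes "CARD('s) = CARD('d)" "inj \<iota>" "inj j"
  shows "\<exists>M. bij M \<and> (\<forall>r. M (\<iota> r) = j r)"
proof -
  have "card (- range \<iota>) = card (- range j)"
    using assms by (simp add: Compl_eq_Diff_UNIV card_Diff_subset card_image)
  then obtain h where h: "bij_betw h (- range \<iota>) (- range j)"
    using finite_same_card_bij[OF finite finite] by metis
  let ?M = "\<lambda>s. if s \<in> range \<iota> then j (inv \<iota> s) else h s"
  have M: "?M (\<iota> r) = j r" for r
    using assms(2) by simp
  have "surj ?M"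
  proof (unfold surj_def, rule allI)
    fix y
    show "\<exists>x. y = ?M x"
    proof (cases "y \<in> range j")
      case True
      then show ?thesis
        using M by (metis rangeE)
    next
      case False
      then obtain x where "x \<in> - range \<iota>" "h x = y"
        using h by (metis ComplI bij_betw_iff_bijections)
      then show ?thesis
        by (metis ComplD)
    qed
  qed
  moreover from this have "inj ?M"
    using assms(1) by (intro eq_card_imp_inj_on[OF finite]) (simp only:)
  ultimately have "bij ?M"
    by (simp only: bij_def)
  then show ?thesis
    using M by blast
qed

text \<open>Injectivity of the dual for a form \<open>T\<close> sitting in the slots
  \<open>\<iota>\<close>. A nonzero component \<open>T $ j\<close> has injective \<open>j\<close>,
  which extends to a bijection \<open>M0\<close>. With the outside slots fixed as in
  \<open>M0\<close>, all nonzero terms of the contraction are equal, so nothing can cancel.\<close>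

lemma antisymmetric_eq_0_if_dual_eq_0:
  fixes N :: "('s::finite, 'd::finite) tensor" and T :: "('r::finite, 'd) tensor" and \<iota> :: "'r \<Rightarrow> 's"
  assumes N: "volume_tensor N" and T: "antisymmetric T" and \<iota>: "inj \<iota>"
    and dual_0: "\<And>m. N \<bullet> (\<chi> M. if \<forall>s. s \<notin> range \<iota> \<longrightarrow> M s = m s then T $ (\<lambda>r. M (\<iota> r)) else 0) = 0"
  shows "T = 0"
proof (rule ccontr)
  assume "T \<noteq> 0"
  then obtain j where j: "T $ j \<noteq> 0"
    by (auto simp: vec_eq_iff)
  then have "inj j"
    using antisymmetric_eq_0[OF T] by blast
  then obtain M0 where M0: "bij M0" "\<And>r. M0 (\<iota> r) = j r"
    using exists_bij_extension[OF _ \<iota>, of j] N by (auto simp: volume_tensor_def)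
  define P where "P M = N $ M * T $ (\<lambda>r. M (\<iota> r))" for M
  have N': "antisymmetric N"
    using N by (simp add: volume_tensor_def)
  \<comment> \<open>\<open>N\<close> and \<open>T\<close> both change sign.\<close>
  have swap_P: "P (M \<circ> Transposition.transpose a b) = P M" if "a \<in> range \<iota>" "b \<in> range \<iota>" "a \<noteq> b" for M a b
  proof -
    obtain a' b' where ab: "a = \<iota> a'" "b = \<iota> b'"
      using \<open>a \<in> range \<iota>\<close> \<open>b \<in> range \<iota>\<close> by blast
    then have "a' \<noteq> b'"
      using \<open>a \<noteq> b\<close> by blast
    have "(\<lambda>r. (M \<circ> Transposition.transpose a b) (\<iota> r)) = (\<lambda>r. M (\<iota> r)) \<circ> Transposition.transpose a' b'"
      using \<iota> by (auto simp: fun_eq_iff ab Transposition.transpose_def inj_eq)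
    then have "T $ (\<lambda>r. (M \<circ> Transposition.transpose a b) (\<iota> r)) = - T $ (\<lambda>r. M (\<iota> r))"
      using antisymmetric_swap[OF T \<open>a' \<noteq> b'\<close>, of "\<lambda>r. M (\<iota> r)"] by (simp only:)
    then show ?thesis
      unfolding P_def using antisymmetric_swap[OF N' \<open>a \<noteq> b\<close>, of M] by (simp only: minus_mult_minus)
  qed
  have perm: "P (M0 \<circ> \<sigma>) = P M0" if "\<sigma> permutes range \<iota>" for \<sigma>
    using finite that
  proof (induction rule: permutes_rev_induct)
    case (swap a b p)
    then show ?case
      using swap_P[OF swap.hyps(1-3), of "M0 \<circ> p"] by (simp only: comp_assoc)
  qed simp
  let ?A = "\<lambda>M. \<forall>s. s \<notin> range \<iota> \<longrightarrow> M s = M0 s"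
  \<comment> \<open>Two bijections that agree outside the slots of \<open>T\<close> differ by a
    permutation of those slots.\<close>
  have P_eq: "P M = P M0" if "?A M" "bij M" for M
  proof -
    have "inv M0 \<circ> M permutes range \<iota>"
    proof (rule bij_imp_permutes)
      have "bij (inv M0 \<circ> M)"
        using M0(1) that(2) by (simp add: bij_comp bij_imp_bij_inv)
      moreover have fix_outside: "(inv M0 \<circ> M) s = s" if "s \<notin> range \<iota>" for s
        using \<open>?A M\<close> that M0(1) by (simp add: bij_is_inj)
      ultimately have "(inv M0 \<circ> M) ` range \<iota> \<subseteq> range \<iota>"
        by (intro image_subsetI) (metis bij_is_inj injD)
      then have "(inv M0 \<circ> M) ` range \<iota> = range \<iota>"
        using inj_on_subset[OF bij_is_inj[OF \<open>bij (inv M0 \<circ> M)\<close>] subset_UNIV]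
        by (intro endo_inj_surj) simp_all
      then show "bij_betw (inv M0 \<circ> M) (range \<iota>) (range \<iota>)"
        unfolding bij_betw_def using inj_on_subset[OF bij_is_inj[OF \<open>bij (inv M0 \<circ> M)\<close>] subset_UNIV] by blast
      show "(inv M0 \<circ> M) s = s" if "s \<notin> range \<iota>" for s
        by (rule fix_outside[OF that])
    qed
    then have "P (M0 \<circ> (inv M0 \<circ> M)) = P M0"
      by (rule perm)
    moreover have "M0 \<circ> (inv M0 \<circ> M) = M"
      using M0(1) by (simp add: fun_eq_iff bij_is_surj surj_f_inv_f)
    ultimately show ?thesis
      by simp
  qed
  have "N \<bullet> (\<chi> M. if ?A M then T $ (\<lambda>r. M (\<iota> r)) else 0) = (\<Sum>M | ?A M \<and> bij M. P M)"
    unfolding inner_vec_def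
  proof (rule sum.mono_neutral_cong_right)
    show "\<forall>M\<in>UNIV - {M. ?A M \<and> bij M}.
      N $ M \<bullet> (\<chi> M. if ?A M then T $ (\<lambda>r. M (\<iota> r)) else 0) $ M = 0"
      using N by (auto simp: volume_tensor_def)
  qed (auto simp: P_def)
  also have "\<dots> = (\<Sum>M | ?A M \<and> bij M. P M0)"
    by (rule sum.cong) (use P_eq in auto)
  also have "\<dots> = real (card {M. ?A M \<and> bij M}) * P M0"
    by simp
  finally have "real (card {M. ?A M \<and> bij M}) * P M0 = 0"
    using dual_0 by simp
  moreover have "M0 \<in> {M. ?A M \<and> bij M}"
    using M0(1) by simp
  then have "card {M. ?A M \<and> bij M} \<noteq> 0"
    unfolding card_eq_0_iff using finite by blast
  moreover have "P M0 \<noteq> 0"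
    using j M0 N by (auto simp: P_def volume_tensor_def)
  ultimately show False
    by (simp only: mult_eq_0_iff of_nat_eq_0_iff simp_thms)
qed

section \<open>Contractions of a volume tensor with forms and vectors\<close>

lemma sum_UNIV_sum:
  fixes f :: "'r::finite + 's::finite \<Rightarrow> real"
  shows "(\<Sum>s\<in>UNIV. f s) = (\<Sum>s\<in>UNIV. f (Inl s)) + (\<Sum>s\<in>UNIV. f (Inr s))"
  by (simp add: UNIV_Plus_UNIV[symmetric] sum.Plus comp_def del: UNIV_Plus_UNIV)

lemma sum_UNIV_option:
  fixes f :: "'s::finite option \<Rightarrow> real"
  shows "(\<Sum>s\<in>UNIV. f s) = f None + (\<Sum>s\<in>UNIV. f (Some s))"
  by (simp add: UNIV_option_conv sum.reindex)

lemma volume_tensor_inner_swap: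
  fixes N T :: "('s::finite, 'd::finite) tensor"
  assumes "volume_tensor N" "s \<noteq> s'"
  shows "N \<bullet> (\<chi> m. T $ (m \<circ> Transposition.transpose s s')) = - (N \<bullet> T)"
proof -
  let ?\<tau> = "Transposition.transpose s s'"
  have "N \<bullet> T = (\<Sum>m\<in>UNIV. N $ (m \<circ> ?\<tau>) * T $ (m \<circ> ?\<tau>))"
    using sum_comp_bij[of ?\<tau> "\<lambda>m. N $ m * T $ m"] by (simp add: inner_tensor)
  also have "\<dots> = (\<Sum>m\<in>UNIV. - (N $ m * T $ (m \<circ> ?\<tau>)))"
  proof (rule sum.cong[OF refl])
    have "antisymmetric N"
      using assms(1) by (simp add: volume_tensor_def)
    then show "N $ (m \<circ> ?\<tau>) * T $ (m \<circ> ?\<tau>) = - (N $ m * T $ (m \<circ> ?\<tau>))" for m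
      by (simp only: antisymmetric_swap[OF _ assms(2)] mult_minus_left)
  qed
  finally show ?thesis
    by (simp add: inner_tensor sum_negf)
qed

text \<open>The product of \<open>B\<close>, \<open>x\<close> and \<open>Z\<close> laid out along
  the slots of epsilon as in \<open>magnetic\<close>: the first half belongs to the dual, with the
  observer contracted into its last slot \<open>None\<close>, and the second half to the
  field.\<close>

definition triple :: "('p::finite, 'd::finite) tensor \<Rightarrow> real ^ 'd \<Rightarrow> ('p option, 'd) tensor \<Rightarrow>
    ('p option + 'p option, 'd) tensor" where
  "triple B x Z = (\<chi> m. B $ (\<lambda>i. m (Inl (Some i))) * x $ m (Inl None) * Z $ (\<lambda>r. m (Inr r)))"

text \<open>The contribution of one slot to the right side of
  \<open>schouten_contract\<close>.\<close>

definition replace_slot ::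
  "'s \<Rightarrow> real ^ 'd \<Rightarrow> real ^ 'd \<Rightarrow> ('s::finite, 'd::finite) tensor \<Rightarrow> ('s, 'd) tensor" where
  "replace_slot r v \<alpha> Z = (\<chi> k. v $ k r * (\<Sum>a\<in>UNIV. \<alpha> $ a * Z $ k(r := a)))"

lemma fun_upd_comp_inj:
  "inj f \<Longrightarrow> (\<lambda>r'. (m(f r := a)) (f r')) = (\<lambda>r'. m (f r'))(r := a)"
  by (auto simp: fun_eq_iff inj_eq)

lemmas fun_upd_slots =
  fun_upd_comp_inj[of Inr, simplified]
  fun_upd_comp_inj[of "\<lambda>i. Inl (Some i)", simplified inj_def, simplified]

text \<open>The Schouten sum is split by the kind of slot: those of \<open>B\<close> drop out by
  transversality, the slot of \<open>w\<close> yields \<open>\<alpha> \<bullet> w\<close> with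
  \<open>v\<close> in its place, and those of \<open>Z\<close> remain.\<close>

lemma triple_schouten:
  fixes B :: "('p::finite, 'd::finite) tensor"
  assumes N: "volume_tensor N" and B: "transverse \<alpha> B"
  shows "(\<alpha> \<bullet> v) * (N \<bullet> triple B w Z)
    = (\<alpha> \<bullet> w) * (N \<bullet> triple B v Z) + (\<Sum>r\<in>UNIV. N \<bullet> triple B w (replace_slot r v \<alpha> Z))"
proof -
  let ?R = "\<lambda>s. \<chi> m. v $ m s * (\<Sum>a\<in>UNIV. \<alpha> $ a * triple B w Z $ m(s := a))"
  have 1: "?R (Inr r) = triple B w (replace_slot r v \<alpha> Z)" for r
    by (simp add: vec_eq_iff triple_def replace_slot_def fun_upd_slots sum_distrib_left ac_simps)
  have 2: "?R (Inl None) = (\<alpha> \<bullet> w) *\<^sub>R triple B v Z"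
    by (simp add: vec_eq_iff triple_def inner_vec_def sum_distrib_left sum_distrib_right ac_simps)
  have 3: "?R (Inl (Some i)) = 0" for i
  proof -
    have "(\<Sum>a\<in>UNIV. \<alpha> $ a * triple B w Z $ m(Inl (Some i) := a)) = 0" for m
    proof -
      have "(\<Sum>a\<in>UNIV. \<alpha> $ a * triple B w Z $ m(Inl (Some i) := a))
        = (\<Sum>a\<in>UNIV. B $ (\<lambda>i. m (Inl (Some i)))(i := a) * \<alpha> $ a) * (w $ m (Inl None) * Z $ (\<lambda>r. m (Inr r)))"
        by (simp add: triple_def fun_upd_slots sum_distrib_left sum_distrib_right ac_simps)
      then show ?thesis
        by (simp add: transverseD[OF B])
    qed
    then show ?thesis
      by (simp add: vec_eq_iff)
  qed
  have "(\<alpha> \<bullet> v) * (N \<bullet> triple B w Z) = (\<Sum>s\<in>UNIV. N \<bullet> ?R s)"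
    by (rule schouten_contract[OF N])
  also have "\<dots> = N \<bullet> ?R (Inl None) + (\<Sum>i\<in>UNIV. N \<bullet> ?R (Inl (Some i))) + (\<Sum>r\<in>UNIV. N \<bullet> ?R (Inr r))"
    by (simp only: sum_UNIV_sum sum_UNIV_option[of "\<lambda>s. N \<bullet> ?R (Inl s)"])
  finally show ?thesis
    by (simp only: 1 2 3 inner_zero_right inner_scaleR_right sum.neutral_const add_0_right)
qed

text \<open>After the replacement both vectors occupy single slots of \<open>N\<close>, namely
  \<open>Inl None\<close> and \<open>Inr r\<close>, so exchanging them costs a sign.\<close>

lemma triple_replace_slot_swap:
  assumes N: "volume_tensor N"
  shows "N \<bullet> triple B w (replace_slot r v \<alpha> Z) = - (N \<bullet> triple B v (replace_slot r w \<alpha> Z))"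
proof -
  have "triple B w (replace_slot r v \<alpha> Z) $ (m \<circ> Transposition.transpose (Inl None) (Inr r))
    = triple B v (replace_slot r w \<alpha> Z) $ m" for m
  proof -
    have "(\<lambda>r'. (m \<circ> Transposition.transpose (Inl None) (Inr r)) (Inr r'))(r := a) = (\<lambda>r'. m (Inr r'))(r := a)" for a
      by (auto simp: fun_eq_iff Transposition.transpose_def)
    then show ?thesis
      by (simp add: triple_def replace_slot_def Transposition.transpose_def)
  qed
  then show ?thesis
    using volume_tensor_inner_swap[OF N, of "Inl None" "Inr r" "triple B w (replace_slot r v \<alpha> Z)"] by simp
qed

text \<open>Schouten turns a triple with an arbitrary \<open>x\<close> into triples with
  \<open>v\<close>, the remaining terms being brought to that form by
  \<open>triple_replace_slot_swap\<close>. So the full dual of \<open>B\<close> vanishes, not only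
  its contraction with \<open>v\<close>.\<close>

lemma tensor_eq_0_if_triple_eq_0:
  fixes B :: "('p::finite, 'd::finite) tensor"
  assumes N: "volume_tensor N" and B: "transverse \<alpha> B" "antisymmetric B" and v: "\<alpha> \<bullet> v \<noteq> 0"
    and triple_0: "\<And>Z. N \<bullet> triple B v Z = 0"
  shows "B = 0"
proof -
  have all_0: "N \<bullet> triple B x Z = 0" for x Z
    using triple_schouten[OF N B(1), of v x Z] v
    by (simp add: triple_0 triple_replace_slot_swap[OF N, of B x _ v])
  show ?thesis
  proof (rule antisymmetric_eq_0_if_dual_eq_0[OF N B(2), where \<iota> = "\<lambda>i. Inl (Some i)"])
    show "inj (\<lambda>i. Inl (Some i))"
      by (simp add: inj_def)
    fix m :: "'p option + 'p option \<Rightarrow> 'd"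
    have "(\<forall>s. s \<notin> range (\<lambda>i. Inl (Some i)) \<longrightarrow> M s = m s)
      \<longleftrightarrow> M (Inl None) = m (Inl None) \<and> (\<lambda>r. M (Inr r)) = (\<lambda>r. m (Inr r))" for M
    proof
      assume *: "M (Inl None) = m (Inl None) \<and> (\<lambda>r. M (Inr r)) = (\<lambda>r. m (Inr r))"
      show "\<forall>s. s \<notin> range (\<lambda>i. Inl (Some i)) \<longrightarrow> M s = m s"
      proof (intro allI impI)
        fix s :: "'p option + 'p option"
        assume "s \<notin> range (\<lambda>i. Inl (Some i))"
        then show "M s = m s"
          using * by (cases s; cases "projl s") (auto simp: fun_eq_iff)
      qed
    qed (auto simp: fun_eq_iff)
    \<comment> \<open>Coordinate arrays for the vector and for \<open>Z\<close> pin the slots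
      outside \<open>B\<close> to the values of \<open>m\<close>.\<close>
    then have "(\<chi> M. if \<forall>s. s \<notin> range (\<lambda>i. Inl (Some i)) \<longrightarrow> M s = m s then B $ (\<lambda>i. M (Inl (Some i))) else 0)
      = triple B (axis (m (Inl None)) 1) (axis (\<lambda>r. m (Inr r)) 1)"
      by (simp add: vec_eq_iff triple_def axis_def)
    then show "N \<bullet> (\<chi> M. if \<forall>s. s \<notin> range (\<lambda>i. Inl (Some i)) \<longrightarrow> M s = m s
      then B $ (\<lambda>i. M (Inl (Some i))) else 0) = 0"
      by (simp only: all_0)
  qed
qed

text \<open>The places of two p-forms among the slots of epsilon; \<open>Inl None\<close> and
  \<open>Inr None\<close> stay free for the two vectors of \<open>quad\<close>.\<close>

definition emb :: "'p + 'p \<Rightarrow> 'p option + 'p option" where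
  "emb = case_sum (\<lambda>i. Inl (Some i)) (\<lambda>i. Inr (Some i))"

lemma inj_emb: "inj emb"
  by (auto simp: inj_def emb_def split: sum.splits)

lemma emb_neq: "emb s \<noteq> Inl None" "emb s \<noteq> Inr None" "Inl None \<noteq> emb s" "Inr None \<noteq> emb s"
  by (auto simp: emb_def split: sum.splits)

lemma not_in_range_emb: "s \<notin> range emb \<longleftrightarrow> s = Inl None \<or> s = Inr None"
proof -
  have "s \<in> range emb" if s: "s \<noteq> Inl None" "s \<noteq> Inr None"
  proof (cases s)
    case (Inl a)
    then obtain i where "s = emb (Inl i)"
      using s Inl by (cases a) (auto simp: emb_def)
    then show ?thesis by blast
  next
    case (Inr a)
    then obtain i where "s = emb (Inr i)"
      using s Inr by (cases a) (auto simp: emb_def)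
    then show ?thesis by blast
  qed
  then show ?thesis
    using emb_neq by blast
qed

definition quad :: "('p::finite + 'p, 'd::finite) tensor \<Rightarrow> real ^ 'd \<Rightarrow> real ^ 'd \<Rightarrow>
    ('p option + 'p option, 'd) tensor" where
  "quad X x y = (\<chi> m. X $ (\<lambda>s. m (emb s)) * x $ m (Inl None) * y $ m (Inr None))"

text \<open>With \<open>\<alpha> \<bullet> w = 0\<close> only the slots of \<open>Z\<close> survive
  in \<open>triple_schouten\<close>. They contribute equally, whence the factor
  \<open>CARD('p option)\<close>, and the last one exhibits the contraction of \<open>Z\<close> with
  \<open>\<alpha>\<close>, which becomes the electric part.\<close>

lemma triple_dual_split:
  fixes Z :: "('p::finite option, 'd::finite) tensor"
  assumes N: "volume_tensor N" and B: "transverse \<alpha> B" and w: "\<alpha> \<bullet> w = 0" and Z: "antisymmetric Z"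
  shows "(\<alpha> \<bullet> v) * (N \<bullet> triple B w Z)
    = real CARD('p option) * (N \<bullet> quad (tensor_product B (contract_last Z \<alpha>)) w v)"
proof -
  \<comment> \<open>Moving the replaced slot from \<open>r\<close> to \<open>None\<close> costs one
    sign in \<open>N\<close> and one in \<open>Z\<close>.\<close>
  have "N \<bullet> triple B w (replace_slot r v \<alpha> Z) = N \<bullet> triple B w (replace_slot None v \<alpha> Z)" for r
  proof (cases r)
    case (Some i)
    let ?\<tau> = "Transposition.transpose (Inr None) (Inr (Some i)) :: 'p option + 'p option \<Rightarrow> _"
    have "triple B w (replace_slot r v \<alpha> Z) $ (m \<circ> ?\<tau>) = - triple B w (replace_slot None v \<alpha> Z) $ m" for m
    proof -
      have "Z $ (\<lambda>r. (m \<circ> ?\<tau>) (Inr r))(Some i := a) = - Z $ (\<lambda>r. m (Inr r))(None := a)" for a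
      proof -
        have "(\<lambda>r. (m \<circ> ?\<tau>) (Inr r))(Some i := a)
          = (\<lambda>r. m (Inr r))(None := a) \<circ> Transposition.transpose None (Some i)"
          by (auto simp: fun_eq_iff Transposition.transpose_def)
        then show ?thesis
          using antisymmetric_swap[OF Z, of None "Some i"] by simp
      qed
      moreover have "(\<lambda>j. (m \<circ> ?\<tau>) (Inl j)) = (\<lambda>j. m (Inl j))"
        by (auto simp: fun_eq_iff Transposition.transpose_def)
      ultimately show ?thesis
        by (simp add: triple_def replace_slot_def Some Transposition.transpose_def sum_negf)
    qed
    then show ?thesis
      using volume_tensor_inner_swap[OF N, of "Inr None" "Inr (Some i)" "triple B w (replace_slot r v \<alpha> Z)"]
        inner_minus_right[of N "triple B w (replace_slot None v \<alpha> Z)"]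
      by (simp add: uminus_vec_def)
  qed simp
  moreover have "triple B w (replace_slot None v \<alpha> Z) = quad (tensor_product B (contract_last Z \<alpha>)) w v"
  proof -
    have "k(None := a) = case_option a (\<lambda>i. k (Some i))" for k :: "'p option \<Rightarrow> 'd" and a
      by (auto simp: fun_eq_iff split: option.split)
    then show ?thesis
      by (simp add: vec_eq_iff triple_def quad_def replace_slot_def tensor_product_def contract_last_def
          emb_def comp_def ac_simps)
  qed
  ultimately show ?thesis
    using triple_schouten[OF N B, of v w Z] w by simp
qed

text \<open>The slots of \<open>X\<close> drop out by transversality, which leaves the two vector
  slots.\<close>

lemma quad_schouten:
  fixes X :: "('p::finite + 'p, 'd::finite) tensor"
  assumes N: "volume_tensor N" and X: "transverse \<alpha> X"
  shows "(\<alpha> \<bullet> v) * (N \<bullet> quad X x y) = (\<alpha> \<bullet> x) * (N \<bullet> quad X v y) + (\<alpha> \<bullet> y) * (N \<bullet> quad X x v)"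
proof -
  let ?R = "\<lambda>s. \<chi> m. v $ m s * (\<Sum>a\<in>UNIV. \<alpha> $ a * quad X x y $ m(s := a))"
  have 1: "?R (Inr None) = (\<alpha> \<bullet> y) *\<^sub>R quad X x v"
    by (simp add: vec_eq_iff quad_def emb_neq inner_vec_def sum_distrib_left sum_distrib_right ac_simps)
  have 2: "?R (Inl None) = (\<alpha> \<bullet> x) *\<^sub>R quad X v y"
    by (simp add: vec_eq_iff quad_def emb_neq inner_vec_def sum_distrib_left sum_distrib_right ac_simps)
  have 3: "?R (emb s) = 0" for s
  proof -
    have "(\<Sum>a\<in>UNIV. \<alpha> $ a * quad X x y $ m(emb s := a)) = 0" for m
    proof -
      have "(\<Sum>a\<in>UNIV. \<alpha> $ a * quad X x y $ m(emb s := a))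
        = (\<Sum>a\<in>UNIV. X $ (\<lambda>s. m (emb s))(s := a) * \<alpha> $ a) * (x $ m (Inl None) * y $ m (Inr None))"
        by (simp add: quad_def emb_neq inj_eq[OF inj_emb] fun_upd_def sum_distrib_left sum_distrib_right ac_simps)
      then show ?thesis
        by (simp add: transverseD[OF X])
    qed
    then show ?thesis
      by (simp add: vec_eq_iff)
  qed
  have "(\<alpha> \<bullet> v) * (N \<bullet> quad X x y) = (\<Sum>s\<in>UNIV. N \<bullet> ?R s)"
    by (rule schouten_contract[OF N])
  also have "\<dots> = (\<Sum>s\<in>{Inl None, Inr None}. N \<bullet> ?R s)"
  proof (rule sum.mono_neutral_right)
    show "\<forall>s\<in>UNIV - {Inl None, Inr None}. N \<bullet> ?R s = 0"
    proof
      fix s :: "'p option + 'p option"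
      assume "s \<in> UNIV - {Inl None, Inr None}"
      then obtain s' where "s = emb s'"
        using not_in_range_emb[of s] by blast
      then show "N \<bullet> ?R s = 0"
        by (simp only: 3 inner_zero_right)
    qed
  qed simp_all
  finally show ?thesis
    by (simp only: 1 2 inner_scaleR_right sum.insert finite.intros) (simp add: 1 2)
qed

lemma quad_swap:
  assumes N: "volume_tensor N"
  shows "N \<bullet> quad X x y = - (N \<bullet> quad X y x)"
proof -
  have "quad X x y $ (m \<circ> Transposition.transpose (Inl None) (Inr None)) = quad X y x $ m" for m
    by (simp add: quad_def Transposition.transpose_def emb_neq)
  then show ?thesis
    using volume_tensor_inner_swap[OF N, of "Inl None" "Inr None" "quad X x y"] by simp
qed

lemma quad_permute:
  fixes X :: "('p::finite + 'p, 'd::finite) tensor"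
  assumes N: "volume_tensor N" and "\<pi> permutes UNIV"
  shows "N \<bullet> quad (\<chi> k. X $ (k \<circ> \<pi>)) x y = of_int (sign \<pi>) * (N \<bullet> quad X x y)"
  using finite[of UNIV] assms(2)
proof (induction arbitrary: X rule: permutes_rev_induct)
  case id
  then show ?case by (simp add: vec_nth_inverse)
next
  case (swap a b p)
  let ?X = "\<chi> k. X $ (k \<circ> Transposition.transpose a b)"
  have "(\<chi> k. X $ (k \<circ> (p \<circ> Transposition.transpose a b))) = (\<chi> k. ?X $ (k \<circ> p))"
    by (simp only: vec_eq_iff vec_lambda_beta comp_assoc simp_thms)
  then have "N \<bullet> quad (\<chi> k. X $ (k \<circ> (p \<circ> Transposition.transpose a b))) x y
    = of_int (sign p) * (N \<bullet> quad ?X x y)"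
    by (simp only: swap.IH)
  moreover have "N \<bullet> quad ?X x y = - (N \<bullet> quad X x y)"
  proof -
    have emb: "emb a \<noteq> emb b"
      using inj_emb \<open>a \<noteq> b\<close> by (meson injD)
    have "quad ?X x y = (\<chi> m. quad X x y $ (m \<circ> Transposition.transpose (emb a) (emb b)))"
    proof -
      have "(\<lambda>s. m (emb s)) \<circ> Transposition.transpose a b
        = (\<lambda>s. (m \<circ> Transposition.transpose (emb a) (emb b)) (emb s))" for m :: "_ \<Rightarrow> 'd"
        by (auto simp: fun_eq_iff Transposition.transpose_def inj_eq[OF inj_emb])
      moreover have "Transposition.transpose (emb a) (emb b) (Inl None) = Inl None"
        "Transposition.transpose (emb a) (emb b) (Inr None) = Inr None"
        by (simp_all add: Transposition.transpose_def emb_neq)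
      ultimately show ?thesis
        by (simp only: vec_eq_iff quad_def vec_lambda_beta comp_apply) simp
    qed
    then show ?thesis
      by (simp only: volume_tensor_inner_swap[OF N emb])
  qed
  moreover have "sign (p \<circ> Transposition.transpose a b) = - sign p"
    using \<open>a \<noteq> b\<close> sign_compose[OF permutes_imp_permutation[OF finite[of UNIV] swap.hyps(4)] permutation_swap_id, of a b]
    by (simp add: sign_swap_id)
  ultimately show ?case
    by (simp only: of_int_minus mult_minus_left mult_minus_right)
qed

section \<open>Antisymmetrization as seen by a volume tensor\<close>

lemma antisymmetrize_eq_sum:
  fixes X :: "('s::finite, 'd::finite) tensor"
  shows "antisymmetrize X
    = (\<Sum>\<pi> | \<pi> permutes UNIV. (of_int (sign \<pi>) / fact CARD('s)) *\<^sub>R (\<chi> k. X $ (k \<circ> \<pi>)))"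
  by (simp add: vec_eq_iff antisymmetrize_def sum_divide_distrib)

lemma linear_quad: "linear (\<lambda>X. quad X x y)"
proof (rule linearI)
  show "quad (X + Y) x y = quad X x y + quad Y x y" for X Y
    by (simp add: vec_eq_iff quad_def algebra_simps)
  show "quad (c *\<^sub>R X) x y = c *\<^sub>R quad X x y" for c X
    by (simp add: vec_eq_iff quad_def algebra_simps)
qed

text \<open>Permuting the slots of \<open>X\<close> multiplies the contraction by the sign of the
  permutation, which squares away the sign in the antisymmetrization; the average is over equal
  terms.\<close>

lemma quad_antisymmetrize:
  fixes X :: "('p::finite + 'p, 'd::finite) tensor"
  assumes N: "volume_tensor N"
  shows "N \<bullet> quad (antisymmetrize X) x y = N \<bullet> quad X x y"
proof -
  have "N \<bullet> quad (antisymmetrize X) x y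
    = (\<Sum>\<pi> | \<pi> permutes (UNIV :: ('p + 'p) set). of_int (sign \<pi>) / fact CARD('p + 'p) * (N \<bullet> quad (\<chi> k. X $ (k \<circ> \<pi>)) x y))"
    by (simp only: antisymmetrize_eq_sum linear_sum[OF linear_quad] linear_scale[OF linear_quad]
        inner_sum_right inner_scaleR_right)
  also have "\<dots> = (\<Sum>\<pi> | \<pi> permutes (UNIV :: ('p + 'p) set). (N \<bullet> quad X x y) / fact CARD('p + 'p))"
  proof (rule sum.cong[OF refl])
    fix \<pi> :: "'p + 'p \<Rightarrow> 'p + 'p"
    assume "\<pi> \<in> {\<pi>. \<pi> permutes UNIV}"
    moreover have "real_of_int (sign \<pi>) * real_of_int (sign \<pi>) = 1"
      by (simp add: sign_def)
    ultimately show "of_int (sign \<pi>) / fact CARD('p + 'p) * (N \<bullet> quad (\<chi> k. X $ (k \<circ> \<pi>)) x y)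
      = (N \<bullet> quad X x y) / fact CARD('p + 'p)"
      using quad_permute[OF N, of \<pi> X x y] by simp
  qed
  also have "\<dots> = N \<bullet> quad X x y"
    using card_permutations[of "UNIV :: ('p + 'p) set", OF refl] by simp
  finally show ?thesis .
qed

lemma antisymmetric_antisymmetrize:
  fixes X :: "('s::finite, 'd::finite) tensor"
  shows "antisymmetric (antisymmetrize X)"
  unfolding antisymmetric_def
proof (intro allI impI)
  fix \<rho> :: "'s \<Rightarrow> 's" and m :: "'s \<Rightarrow> 'd"
  assume \<rho>: "\<rho> permutes UNIV"
  have sign_\<rho>: "real_of_int (sign \<rho>) * real_of_int (sign \<rho>) = 1"
    by (simp add: sign_def)
  have "(\<Sum>\<pi> | \<pi> permutes UNIV. of_int (sign \<pi>) * X $ (m \<circ> \<pi>))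
    = (\<Sum>\<pi> | \<pi> permutes UNIV. of_int (sign (\<rho> \<circ> \<pi>)) * X $ (m \<circ> (\<rho> \<circ> \<pi>)))"
    by (rule setum_permutations_compose_left[OF \<rho>])
  also have "\<dots> = (\<Sum>\<pi> | \<pi> permutes UNIV. of_int (sign \<rho>) * (of_int (sign \<pi>) * X $ (m \<circ> \<rho> \<circ> \<pi>)))"
  proof (rule sum.cong[OF refl])
    fix \<pi> :: "'s \<Rightarrow> 's"
    assume "\<pi> \<in> {\<pi>. \<pi> permutes UNIV}"
    then have "sign (\<rho> \<circ> \<pi>) = sign \<rho> * sign \<pi>"
      using \<rho> permutes_imp_permutation[OF finite[of UNIV]] by (intro sign_compose) auto
    then show "of_int (sign (\<rho> \<circ> \<pi>)) * X $ (m \<circ> (\<rho> \<circ> \<pi>))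
      = of_int (sign \<rho>) * (of_int (sign \<pi>) * X $ (m \<circ> \<rho> \<circ> \<pi>))"
      by (simp only: of_int_mult mult.assoc comp_assoc)
  qed
  finally have "(\<Sum>\<pi> | \<pi> permutes UNIV. of_int (sign \<pi>) * X $ (m \<circ> \<pi>))
    = of_int (sign \<rho>) * (\<Sum>\<pi> | \<pi> permutes UNIV. of_int (sign \<pi>) * X $ (m \<circ> \<rho> \<circ> \<pi>))"
    by (simp only: sum_distrib_left)
  then have "of_int (sign \<rho>) * (\<Sum>\<pi> | \<pi> permutes UNIV. of_int (sign \<pi>) * X $ (m \<circ> \<pi>))
    = (\<Sum>\<pi> | \<pi> permutes UNIV. of_int (sign \<pi>) * X $ (m \<circ> \<rho> \<circ> \<pi>))"
    using sign_\<rho> by (simp only: mult.assoc[symmetric] mult_1_left)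
  then show "antisymmetrize X $ (m \<circ> \<rho>) = of_int (sign \<rho>) * antisymmetrize X $ m"
    by (simp add: antisymmetrize_def)
qed

lemma change_indices_antisymmetrize:
  fixes X :: "('s::finite, 'd::finite) tensor"
  shows "change_indices M (antisymmetrize X) = antisymmetrize (change_indices M X)"
proof -
  have "change_indices M (\<chi> k. X $ (k \<circ> \<pi>)) = (\<chi> k. change_indices M X $ (k \<circ> \<pi>))"
    if "\<pi> permutes UNIV" for \<pi> :: "'s \<Rightarrow> 's"
    using change_indices_permute[OF permutes_bij[OF that], of M X] by (simp add: vec_eq_iff)
  then show ?thesis
    by (simp add: antisymmetrize_eq_sum linear_sum[OF linear_change_indices] change_indices_scaleR)
qed

text \<open>The space orthogonal to the observer has dimension 2p + 1, where a 2p-form is dual to a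
  vector; testing against all \<open>w\<close> in that space therefore decides whether the form
  vanishes.\<close>

lemma antisymmetrize_eq_0_iff:
  fixes X :: "('p::finite + 'p, 'd::finite) tensor"
  assumes N: "volume_tensor N" and X: "transverse \<alpha> X" and v: "\<alpha> \<bullet> v \<noteq> 0"
  shows "antisymmetrize X = 0 \<longleftrightarrow> (\<forall>w. \<alpha> \<bullet> w = 0 \<longrightarrow> N \<bullet> quad X w v = 0)"
proof
  assume "antisymmetrize X = 0"
  then have "N \<bullet> quad (antisymmetrize X) w v = 0" for w
    by (simp add: quad_def zero_vec_def[symmetric])
  then show "\<forall>w. \<alpha> \<bullet> w = 0 \<longrightarrow> N \<bullet> quad X w v = 0"
    by (simp add: quad_antisymmetrize[OF N])
next
  assume *: "\<forall>w. \<alpha> \<bullet> w = 0 \<longrightarrow> N \<bullet> quad X w v = 0"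
  have w: "N \<bullet> quad X w v = 0" for w
  proof -
    \<comment> \<open>Subtracting \<open>c *\<^sub>R v\<close> makes \<open>w\<close> orthogonal to
      \<open>\<alpha>\<close>; the part along \<open>v\<close> drops out, as \<open>v\<close> then
      stands in both vector slots.\<close>
    define c where "c = (\<alpha> \<bullet> w) / (\<alpha> \<bullet> v)"
    have "quad X w v = quad X (w - c *\<^sub>R v) v + c *\<^sub>R quad X v v"
      by (simp add: vec_eq_iff quad_def algebra_simps)
    moreover have "\<alpha> \<bullet> (w - c *\<^sub>R v) = 0"
      using v by (simp add: c_def inner_diff_right)
    moreover have "N \<bullet> quad X v v = 0"
      using quad_swap[OF N, of X v v] by simp
    ultimately show ?thesis
      using * by (simp add: inner_add_right)
  qed
  \<comment> \<open>Schouten puts \<open>v\<close> into one of the two vector slots, which reduces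
    arbitrary \<open>x\<close> and \<open>y\<close> to the case just settled.\<close>
  have all_0: "N \<bullet> quad (antisymmetrize X) x y = 0" for x y
    using quad_schouten[OF N X, of v x y] v quad_swap[OF N, of X v y]
    by (simp add: w quad_antisymmetrize[OF N])
  show "antisymmetrize X = 0"
  proof (rule antisymmetric_eq_0_if_dual_eq_0[OF N antisymmetric_antisymmetrize inj_emb])
    fix m :: "'p option + 'p option \<Rightarrow> 'd"
    have "(\<chi> M. if \<forall>s. s \<notin> range emb \<longrightarrow> M s = m s then antisymmetrize X $ (\<lambda>r. M (emb r)) else 0)
      = quad (antisymmetrize X) (axis (m (Inl None)) 1) (axis (m (Inr None)) 1)"
      by (auto simp: vec_eq_iff quad_def axis_def not_in_range_emb)
    then show "N \<bullet> (\<chi> M. if \<forall>s. s \<notin> range emb \<longrightarrow> M s = m s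
      then antisymmetrize X $ (\<lambda>r. M (emb r)) else 0) = 0"
      by (simp only: all_0)
  qed
qed

subsection \<open>Lorentzian metrics and boosts\<close>

lemma inner_matrix_vector: "(A *v x) \<bullet> y = x \<bullet> (transpose A *v y)" for A :: "real ^ 'n::finite ^ 'm::finite"
  by (simp only: transpose_matrix_vector inner_commute[of x] dot_lmul_matrix) (rule inner_commute)

lemma matrix_add_rdistrib: "(B + C) ** A = B ** A + C ** A"
  by (simp add: vec_eq_iff matrix_matrix_mult_def distrib_right sum.distrib)

lemma minkowski_square:
  fixes t :: "'d::finite"
  defines "\<eta> \<equiv> (\<chi> i j. if i = j then (if i = t then -1 else 1) else 0) :: real ^ 'd ^ 'd"
  shows "\<eta> ** \<eta> = mat 1"
proof -
  have "(\<Sum>k\<in>UNIV. \<eta> $ i $ k * \<eta> $ k $ j) = (\<Sum>k\<in>{i}. \<eta> $ i $ k * \<eta> $ k $ j)" for i j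
    by (rule sum.mono_neutral_right) (auto simp: \<eta>_def)
  then show ?thesis
    by (simp add: vec_eq_iff matrix_matrix_mult_def mat_def) (simp add: \<eta>_def)
qed

lemma invertible_lorentzian:
  assumes "lorentzian g"
  shows "invertible g"
proof -
  obtain A :: "real ^ 'a ^ 'a" and t where
    A: "transpose A ** g ** A = (\<chi> i j. if i = j then (if i = t then -1 else 1) else 0)"
    using assms unfolding lorentzian_def by blast
  let ?\<eta> = "(\<chi> i j. if i = j then (if i = t then -1 else 1) else 0) :: real ^ 'a ^ 'a"
  have "transpose A ** g ** A ** ?\<eta> = mat 1"
    by (simp only: A minkowski_square)
  then have "det (transpose A ** g ** A ** ?\<eta>) = 1"
    by (simp only: det_I)
  then have "det g \<noteq> 0"
    by (auto simp: det_mul)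
  then show ?thesis
    by (simp add: invertible_det_nz)
qed

lemma symmetric_lorentzian: "lorentzian g \<Longrightarrow> transpose g = g"
  by (simp add: lorentzian_def)

lemma
  assumes "invertible (g :: real ^ 'd::finite ^ 'd)"
  shows matrix_inv_left': "matrix_inv g ** g = mat 1"
    and matrix_inv_right': "g ** matrix_inv g = mat 1"
proof -
  have "\<exists>g'. g ** g' = mat 1 \<and> g' ** g = mat 1"
    using assms by (simp add: invertible_def)
  then have "g ** matrix_inv g = mat 1 \<and> matrix_inv g ** g = mat 1"
    unfolding matrix_inv_def by (rule someI_ex)
  then show "matrix_inv g ** g = mat 1" "g ** matrix_inv g = mat 1"
    by simp_all
qed

lemma matrix_inv_unique_right:
  fixes g :: "real ^ 'd::finite ^ 'd"
  assumes "g ** h = mat 1"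
  shows "matrix_inv g = h"
proof -
  have "h ** g = mat 1"
    using assms by (simp add: matrix_left_right_inverse)
  then have "invertible g"
    using assms by (auto simp: invertible_def)
  then have "matrix_inv g ** (g ** h) = h"
    by (simp add: matrix_mul_assoc matrix_inv_left')
  then show ?thesis
    using assms by simp
qed

lemma transpose_matrix_inv:
  fixes g :: "real ^ 'd::finite ^ 'd"
  assumes "transpose g = g" "invertible g"
  shows "transpose (matrix_inv g) = matrix_inv g"
proof -
  have "transpose (matrix_inv g ** g) = mat 1"
    using assms(2) by (simp add: matrix_inv_left')
  then show ?thesis
    using assms(1) by (metis matrix_inv_unique_right matrix_transpose_mul)
qed

lemma ginner_commute:
  fixes g :: "real ^ 'd::finite ^ 'd"
  assumes "transpose g = g"
  shows "x \<bullet> (g *v y) = y \<bullet> (g *v x)"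
  using inner_matrix_vector[of g x y] assms by (simp add: inner_commute[of "g *v x"] del: transpose_matrix_vector)

text \<open>Invariance of the inverse metric, the form in which complete contractions of lower-index
  tensors need it. \<open>isometryI\<close> derives it from invariance of the metric.\<close>

definition isometry :: "'d::finite metric_tensor \<Rightarrow> real ^ 'd ^ 'd \<Rightarrow> bool" where
  "isometry g L \<longleftrightarrow> L ** matrix_inv g ** transpose L = matrix_inv g"

lemma isometryI:
  fixes g L :: "real ^ 'd::finite ^ 'd"
  assumes g: "invertible g" and L: "\<And>x y. (L *v x) \<bullet> (g *v (L *v y)) = x \<bullet> (g *v y)"
  shows "isometry g L"
proof -
  have "x \<bullet> ((transpose L ** g ** L) *v y) = x \<bullet> (g *v y)" for x y
    using L[of x y] inner_matrix_vector[of L x]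
    by (simp add: matrix_vector_mul_assoc matrix_mul_assoc del: transpose_matrix_vector)
  then have "transpose L ** g ** L = g"
    by (metis matrix_eq vector_eq_ldot)
  then have "(matrix_inv g ** transpose L ** g) ** L = mat 1"
    using matrix_inv_left'[OF g] by (metis matrix_mul_assoc)
  \<comment> \<open>A left inverse of a square matrix is a right inverse, which brings
    \<open>L\<close> to the front.\<close>
  then have "L ** (matrix_inv g ** transpose L ** g) = mat 1"
    by (simp add: matrix_left_right_inverse)
  then have "L ** (matrix_inv g ** transpose L ** g) ** matrix_inv g = matrix_inv g"
    by simp
  moreover have "L ** (matrix_inv g ** transpose L ** g) ** matrix_inv g
    = L ** matrix_inv g ** transpose L ** (g ** matrix_inv g)"
    by (simp only: matrix_mul_assoc)
  ultimately show ?thesis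
    by (simp add: isometry_def matrix_inv_right'[OF g])
qed

text \<open>The product of the reflections in \<open>v\<close> and in \<open>v + u\<close>: a boost taking \<open>v\<close> to \<open>u\<close>.\<close>

definition boost :: "'d::finite metric_tensor \<Rightarrow> real ^ 'd \<Rightarrow> real ^ 'd \<Rightarrow> real ^ 'd ^ 'd" where
  "boost g v u = (\<chi> i j. (if i = j then 1 else 0)
     - (v + u) $ i * (g *v (v + u)) $ j / (u \<bullet> (g *v v) - 1) - 2 * u $ i * (g *v v) $ j)"

lemma boost_apply:
  "boost g v u *v x = x - (((g *v (v + u)) \<bullet> x) / (u \<bullet> (g *v v) - 1)) *\<^sub>R (v + u)
    - (2 * ((g *v v) \<bullet> x)) *\<^sub>R u"
proof (subst vec_eq_iff, rule allI)
  fix i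
  let ?c = "u \<bullet> (g *v v) - 1"
  have "(boost g v u *v x) $ i = (\<Sum>j\<in>UNIV. (if i = j then 1 else 0) * x $ j)
    - (\<Sum>j\<in>UNIV. (v + u) $ i / ?c * ((g *v (v + u)) $ j * x $ j))
    - (\<Sum>j\<in>UNIV. 2 * u $ i * ((g *v v) $ j * x $ j))"
  proof -
    have "(boost g v u *v x) $ i = (\<Sum>j\<in>UNIV. boost g v u $ i $ j * x $ j)"
      by (simp add: matrix_vector_mult_def)
    also have "\<dots> = (\<Sum>j\<in>UNIV. (if i = j then 1 else 0) * x $ j
      - (v + u) $ i / ?c * ((g *v (v + u)) $ j * x $ j) - 2 * u $ i * ((g *v v) $ j * x $ j))"
      by (intro sum.cong refl) (simp add: boost_def left_diff_distrib)
    finally show ?thesis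
      by (simp only: sum_subtractf)
  qed
  also have "(\<Sum>j\<in>UNIV. (if i = j then 1 else 0) * x $ j) = x $ i"
    by (simp add: if_distribR if_distrib cong: if_cong)
  finally have "(boost g v u *v x) $ i = x $ i - (v + u) $ i / ?c * ((g *v (v + u)) \<bullet> x)
    - 2 * u $ i * ((g *v v) \<bullet> x)"
    by (simp only: inner_vec_def inner_real_def sum_distrib_left)
  then show "(boost g v u *v x) $ i = (x - (((g *v (v + u)) \<bullet> x) / ?c) *\<^sub>R (v + u)
    - (2 * ((g *v v) \<bullet> x)) *\<^sub>R u) $ i"
    by simp
qed

text \<open>The square of \<open>v + u\<close> is \<open>2 * (u \<bullet> (g *v v) - 1)\<close>:
  this explains the denominator of \<open>boost\<close>, and \<open>uv\<close> says that the second
  mirror vector is not null. The first reflection sends \<open>v\<close> to \<open>- v\<close>, the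
  second sends \<open>- v\<close> to \<open>u\<close>.\<close>

lemma boost_isometry:
  fixes g :: "'d::finite metric_tensor"
  assumes g: "lorentzian g" and v: "unit_timelike g v" and u: "unit_timelike g u"
    and uv: "u \<bullet> (g *v v) \<noteq> 1"
  shows "isometry g (boost g v u)" and "boost g v u *v v = u"
proof -
  note sym = symmetric_lorentzian[OF g]
  define c where "c = u \<bullet> (g *v v)"
  have c: "c - 1 \<noteq> 0"
    using uv by (simp add: c_def)
  have vv: "v \<bullet> (g *v v) = - 1" and uu: "u \<bullet> (g *v u) = - 1"
    using u v by (simp_all add: unit_timelike_def)
  have vu: "v \<bullet> (g *v u) = c"
    using ginner_commute[OF sym] by (simp add: c_def)
  have gl: "(g *v y) \<bullet> x = y \<bullet> (g *v x)" for x y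
    using inner_matrix_vector[of g y x] sym by (simp del: transpose_matrix_vector)
  define a where "a x = (v \<bullet> (g *v x) + u \<bullet> (g *v x)) / (c - 1)" for x
  have L: "boost g v u *v x = x - a x *\<^sub>R (v + u) - (2 * (v \<bullet> (g *v x))) *\<^sub>R u" for x
    unfolding boost_apply a_def gl by (simp add: c_def[symmetric] inner_add_left)
  have "(boost g v u *v x) \<bullet> (g *v (boost g v u *v y)) = x \<bullet> (g *v y)" for x y
  proof -
    have ax: "a x * (c - 1) = v \<bullet> (g *v x) + u \<bullet> (g *v x)"
      and ay: "a y * (c - 1) = v \<bullet> (g *v y) + u \<bullet> (g *v y)"
      using c by (simp_all add: a_def)
    have xv: "x \<bullet> (g *v v) = v \<bullet> (g *v x)" and xu: "x \<bullet> (g *v u) = u \<bullet> (g *v x)"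
      by (rule ginner_commute[OF sym])+
    \<comment> \<open>With \<open>a x\<close> and \<open>a y\<close> kept as unknowns subject to
      \<open>ax\<close> and \<open>ay\<close>, the claim is a polynomial identity.\<close>
    show ?thesis
      using ax ay unfolding L
      by (simp add: matrix_vector_mult_diff_distrib matrix_vector_right_distrib
          matrix_vector_mult_scaleR inner_diff_left inner_diff_right inner_add_left inner_add_right
          vv uu vu xv xu c_def[symmetric]) algebra
  qed
  then show "isometry g (boost g v u)"
    by (rule isometryI[OF invertible_lorentzian[OF g]])
  have "a v = 1"
    using c by (simp add: a_def vv c_def[symmetric])
  then show "boost g v u *v v = u"
    unfolding L by (simp add: vv scaleR_2)
qed

lemma outer_product_conj:
  fixes L :: "real ^ 'd::finite ^ 'd"
  shows "L ** (\<chi> i j. x $ i * y $ j) ** transpose L = (\<chi> i j. (L *v x) $ i * (L *v y) $ j)"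
proof -
  have "(L ** (\<chi> i j. x $ i * y $ j) ** transpose L) $ i $ j = (L *v x) $ i * (L *v y) $ j" for i j
    unfolding matrix_matrix_mult_def matrix_vector_mult_def transpose_def
    by (simp add: sum_distrib_left sum_distrib_right ac_simps)
  then show ?thesis
    by (simp add: vec_eq_iff)
qed

text \<open>The Minkowski matrix is \<open>mat 1\<close> minus twice the projection to the time
  axis. Conjugation with the frame \<open>A\<close> carries this over, and \<open>a\<close> is the
  timelike vector of the frame.\<close>

lemma matrix_inv_lorentzian:
  fixes g :: "'d::finite metric_tensor"
  assumes g: "lorentzian g"
  obtains A :: "real ^ 'd ^ 'd" and a where "invertible A" "unit_timelike g a"
    "matrix_inv g = A ** transpose A + (\<chi> i j. (- 2 *\<^sub>R a) $ i * a $ j)"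
proof -
  obtain A :: "real ^ 'd ^ 'd" and t where A: "invertible A"
    "transpose A ** g ** A = (\<chi> i j. if i = j then (if i = t then -1 else 1) else 0)"
    using g unfolding lorentzian_def by blast
  let ?\<eta> = "(\<chi> i j. if i = j then (if i = t then -1 else 1) else 0) :: real ^ 'd ^ 'd"
  have "transpose A ** (g ** A ** ?\<eta>) = ?\<eta> ** ?\<eta>"
    by (simp only: A(2) matrix_mul_assoc)
  then have "(g ** A ** ?\<eta>) ** transpose A = mat 1"
    by (simp only: minkowski_square matrix_left_right_inverse[of "transpose A"])
  then have "g ** (A ** ?\<eta> ** transpose A) = mat 1"
    by (simp only: matrix_mul_assoc)
  then have inv: "matrix_inv g = A ** ?\<eta> ** transpose A"
    by (rule matrix_inv_unique_right)
  define a where "a = A *v axis t 1"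
  have "?\<eta> = mat 1 + (\<chi> i j. (- 2 *\<^sub>R axis t 1 :: real ^ 'd) $ i * (axis t 1 :: real ^ 'd) $ j)"
    by (auto simp: vec_eq_iff mat_def axis_def)
  then have "matrix_inv g = A ** transpose A
    + A ** (\<chi> i j. (- 2 *\<^sub>R axis t 1 :: real ^ 'd) $ i * (axis t 1 :: real ^ 'd) $ j) ** transpose A"
    using inv by (simp only: matrix_add_ldistrib matrix_add_rdistrib matrix_mul_rid)
  then have "matrix_inv g = A ** transpose A + (\<chi> i j. (- 2 *\<^sub>R a) $ i * a $ j)"
    by (simp only: outer_product_conj a_def matrix_vector_mult_scaleR)
  moreover have "unit_timelike g a"
  proof -
    have "a \<bullet> (g *v a) = axis t 1 \<bullet> ((transpose A ** g ** A) *v axis t 1)"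
      unfolding a_def inner_matrix_vector
      by (simp add: matrix_vector_mul_assoc matrix_mul_assoc del: transpose_matrix_vector)
    also have "\<dots> = - 1"
      unfolding A(2) by (simp add: inner_axis' matrix_vector_mult_basis column_def)
    finally show ?thesis
      by (simp add: unit_timelike_def)
  qed
  ultimately show thesis
    by (intro that[OF A(1)])
qed

text \<open>A boost from the timelike vector of some frame to \<open>v\<close> preserves the inverse
  metric and moves the decomposition along.\<close>

lemma matrix_inv_lorentzian_adapted:
  fixes g :: "'d::finite metric_tensor"
  assumes g: "lorentzian g" and v: "unit_timelike g v"
  obtains A :: "real ^ 'd ^ 'd" where "invertible A" "matrix_inv g = A ** transpose A + (\<chi> i j. (- 2 *\<^sub>R v) $ i * v $ j)"
proof -
  obtain A :: "real ^ 'd ^ 'd" and a where A: "invertible A" "unit_timelike g a"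
    "matrix_inv g = A ** transpose A + (\<chi> i j. (- 2 *\<^sub>R a) $ i * a $ j)"
    by (rule matrix_inv_lorentzian[OF g])
  \<comment> \<open>The sign avoids the one value at which the boost degenerates; the decomposition
    is quadratic in \<open>a\<close>, hence blind to it.\<close>
  define b where "b = (if v \<bullet> (g *v a) = 1 then - a else a)"
  have b: "unit_timelike g b" "v \<bullet> (g *v b) \<noteq> 1"
    using A(2) matrix_vector_mult_scaleR[of g "- 1" a]
    by (auto simp: b_def unit_timelike_def)
  have inv: "matrix_inv g = A ** transpose A + (\<chi> i j. (- 2 *\<^sub>R b) $ i * b $ j)"
    unfolding A(3) by (simp add: b_def vec_eq_iff)
  let ?L = "boost g b v"
  note L = boost_isometry[OF g b(1) v b(2)]
  have "invertible (?L ** matrix_inv g ** transpose ?L)"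
    using L(1) invertible_lorentzian[OF g] by (simp add: isometry_def invertible_def) (metis matrix_inv_left' matrix_inv_right' invertible_lorentzian[OF g])
  then have "invertible ?L"
    by (simp add: invertible_det_nz det_mul)
  have "matrix_inv g = ?L ** (A ** transpose A + (\<chi> i j. (- 2 *\<^sub>R b) $ i * b $ j)) ** transpose ?L"
    using L(1) inv by (simp add: isometry_def)
  also have "\<dots> = (?L ** A) ** transpose (?L ** A) + (\<chi> i j. (- 2 *\<^sub>R v) $ i * v $ j)"
    by (simp only: matrix_add_ldistrib matrix_add_rdistrib outer_product_conj matrix_transpose_mul
        matrix_mul_assoc matrix_vector_mult_scaleR L(2))
  finally show thesis
    by (rule that[OF invertible_mult[OF \<open>invertible ?L\<close> A(1)]])
qed

text \<open>A transverse tensor annihilates the rank-one term, so only the positive part of the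
  inverse metric acts on it.\<close>

lemma raise_transverse:
  fixes g A :: "'d::finite metric_tensor" and X :: "('s::finite, 'd) tensor"
  assumes "matrix_inv g = A ** transpose A + (\<chi> i j. (- 2 *\<^sub>R v) $ i * v $ j)" "transverse v X"
  shows "raise_indices g X = change_indices A (change_indices (transpose A) X)"
  unfolding assms(1) by (subst change_indices_add_transverse[OF assms(2)]) (simp add: change_indices_compose)

lemma inner_raise_transverse:
  fixes g A :: "'d::finite metric_tensor" and X :: "('s::finite, 'd) tensor"
  assumes "matrix_inv g = A ** transpose A + (\<chi> i j. (- 2 *\<^sub>R v) $ i * v $ j)" "transverse v X"
  shows "raise_indices g X \<bullet> Y = change_indices (transpose A) X \<bullet> change_indices (transpose A) Y"
  by (simp add: raise_transverse[OF assms] change_indices_adjoint)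

lemma change_indices_inverse:
  fixes T :: "('s::finite, 'd::finite) tensor"
  assumes "M ** M' = mat 1"
  shows "change_indices M (change_indices M' T) = T"
  by (simp add: change_indices_compose assms)

lemma lower_raise:
  fixes T :: "('s::finite, 'd::finite) tensor"
  assumes "invertible g"
  shows "lower_indices g (raise_indices g T) = T" "raise_indices g (lower_indices g T) = T"
  using assms by (simp_all add: change_indices_inverse matrix_inv_left' matrix_inv_right')

text \<open>In the adapted frame the contraction of \<open>X\<close> with itself is a Euclidean
  square, and the change of frame is invertible.\<close>

lemma raise_positive:
  fixes X :: "('s::finite, 'd::finite) tensor"
  assumes "lorentzian g" "unit_timelike g v" "transverse v X" "raise_indices g X \<bullet> X = 0"
  shows "X = 0"
proof -
  obtain A :: "real ^ 'd ^ 'd" where A: "invertible A"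
    "matrix_inv g = A ** transpose A + (\<chi> i j. (- 2 *\<^sub>R v) $ i * v $ j)"
    by (rule matrix_inv_lorentzian_adapted[OF assms(1,2)])
  have "change_indices (transpose A) X = 0"
    using assms(4) by (simp add: inner_raise_transverse[OF A(2) assms(3)])
  moreover have "transpose (matrix_inv A) ** transpose A = mat 1"
    using A(1) by (simp add: matrix_transpose_mul[symmetric] matrix_inv_right')
  ultimately show ?thesis
    by (metis change_indices_0 change_indices_inverse)
qed

lemma raise_symmetric:
  fixes X Y :: "('s::finite, 'd::finite) tensor"
  assumes "lorentzian g"
  shows "raise_indices g X \<bullet> Y = X \<bullet> raise_indices g Y"
  using assms
  by (simp add: change_indices_adjoint transpose_matrix_inv symmetric_lorentzian invertible_lorentzian)

lemma transverse_raise: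
  assumes "lorentzian g" "transverse v X"
  shows "transverse (g *v v) (raise_indices g X)"
proof (rule transverse_change_indices)
  have "transpose (matrix_inv g) *v (g *v v) = v"
    using assms(1)
    by (simp add: transpose_matrix_inv symmetric_lorentzian invertible_lorentzian
        matrix_vector_mul_assoc matrix_inv_left' del: transpose_matrix_vector)
  then show "transverse (transpose (matrix_inv g) *v (g *v v)) X"
    using assms(2) by (simp only:)
qed

subsection \<open>Duals and the decomposition into electric and magnetic parts\<close>

lemma case_sum_swap: "case_sum (i \<circ> Transposition.transpose a b) j
    = case_sum i j \<circ> Transposition.transpose (Inl a) (Inl b)"
    "case_sum i (j \<circ> Transposition.transpose a b) = case_sum i j \<circ> Transposition.transpose (Inr a) (Inr b)"
  by (auto simp: fun_eq_iff Transposition.transpose_def split: sum.split)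

lemma case_option_swap: "case_option x (m \<circ> Transposition.transpose a b)
    = case_option x m \<circ> Transposition.transpose (Some a) (Some b)"
  by (auto simp: fun_eq_iff Transposition.transpose_def split: option.split)

text \<open>Raising all of epsilon and lowering the free half again cancels there; on the contracted
  half, symmetry of the inverse metric shifts the raising to \<open>F\<close>.\<close>

lemma dual_nth:
  fixes F :: "('r::finite, 'd::finite) tensor"
  assumes g: "transpose g = g" "invertible g"
  shows "dual g e F $ m = (\<Sum>k\<in>UNIV. levi_civita g e $ case_sum m k * raise_indices g F $ k) / fact CARD('r)"
proof -
  let ?M = "matrix_inv g" and ?N = "levi_civita g e"
  define Y where "Y = (\<chi> i. \<Sum>j\<in>UNIV. ?N $ case_sum i j * raise_indices g F $ j)"
  have sym: "?M $ i $ j = ?M $ j $ i" for i j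
  proof -
    have "?M $ i $ j = transpose ?M $ j $ i"
      by (simp add: transpose_def)
    then show ?thesis
      by (simp only: transpose_matrix_inv[OF g])
  qed
  have "(\<Sum>k\<in>UNIV. raise_indices g ?N $ case_sum m k * F $ k) = raise_indices g Y $ m" for m
  proof -
    have "(\<Sum>k\<in>UNIV. raise_indices g ?N $ case_sum m k * F $ k)
      = (\<Sum>k\<in>UNIV. \<Sum>i\<in>UNIV. \<Sum>j\<in>UNIV. (\<Prod>s\<in>UNIV. ?M $ m s $ i s) * (\<Prod>s\<in>UNIV. ?M $ j s $ k s) *
          ?N $ case_sum i j * F $ k)"
    proof (rule sum.cong[OF refl])
      fix k :: "'r \<Rightarrow> 'd"
      have "(\<Prod>s\<in>UNIV. ?M $ k s $ j s) = (\<Prod>s\<in>UNIV. ?M $ j s $ k s)" for j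
        by (rule prod.cong[OF refl], rule sym)
      then show "raise_indices g ?N $ case_sum m k * F $ k
        = (\<Sum>i\<in>UNIV. \<Sum>j\<in>UNIV. (\<Prod>s\<in>UNIV. ?M $ m s $ i s) * (\<Prod>s\<in>UNIV. ?M $ j s $ k s) *
          ?N $ case_sum i j * F $ k)"
        by (simp add: change_indices_nth sum_fun_sum prod_UNIV_sum sum_distrib_right)
    qed
    also have "\<dots> = (\<Sum>i\<in>UNIV. \<Sum>k\<in>UNIV. \<Sum>j\<in>UNIV. (\<Prod>s\<in>UNIV. ?M $ m s $ i s) * (\<Prod>s\<in>UNIV. ?M $ j s $ k s) *
          ?N $ case_sum i j * F $ k)"
      by (rule sum.swap)
    also have "\<dots> = (\<Sum>i\<in>UNIV. \<Sum>j\<in>UNIV. \<Sum>k\<in>UNIV. (\<Prod>s\<in>UNIV. ?M $ m s $ i s) * (\<Prod>s\<in>UNIV. ?M $ j s $ k s) *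
          ?N $ case_sum i j * F $ k)"
      by (rule sum.cong[OF refl], rule sum.swap)
    also have "\<dots> = raise_indices g Y $ m"
      by (simp add: change_indices_nth Y_def sum_distrib_left ac_simps)
    finally show ?thesis .
  qed
  then have "dual g e F = lower_indices g ((1 / fact CARD('r)) *\<^sub>R raise_indices g Y)"
    unfolding dual_def by (intro arg_cong[where f = "lower_indices g"]) (simp add: vec_eq_iff)
  then show ?thesis
    by (simp add: change_indices_scaleR lower_raise[OF g(2)] Y_def)
qed

lemma antisymmetric_dual:
  fixes F :: "('r::finite, 'd::finite) tensor"
  assumes g: "transpose g = g" "invertible g" and e: "bij e"
  shows "antisymmetric (dual g e F)"
proof -
  have N: "antisymmetric (levi_civita g e)"
    using volume_tensor_levi_civita[OF e] g(2) by (simp add: volume_tensor_def invertible_det_nz)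
  show ?thesis
    unfolding antisymmetric_iff_swap
  proof (intro allI impI)
    fix a b :: 'r and m :: "'r \<Rightarrow> 'd"
    assume "a \<noteq> b"
    then have "levi_civita g e $ case_sum (m \<circ> Transposition.transpose a b) k = - levi_civita g e $ case_sum m k" for k
      unfolding case_sum_swap by (intro antisymmetric_swap[OF N]) simp
    then show "dual g e F $ (m \<circ> Transposition.transpose a b) = - dual g e F $ m"
      by (simp only: dual_nth[OF g] mult_minus_left sum_negf minus_divide_left)
  qed
qed

lemma linear_dual:
  assumes g: "transpose g = g" "invertible g"
  shows "linear (dual g e)"
  by (rule linearI)
    (simp_all add: vec_eq_iff dual_nth[OF g] change_indices_add change_indices_scaleR
      distrib_left sum.distrib add_divide_distrib sum_distrib_left sum_divide_distrib ac_simps)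

lemma linear_contract_last: "linear (\<lambda>T. contract_last T v)"
proof (rule linearI)
  show "contract_last (S + T) v = contract_last S v + contract_last T v" for S T
    by (simp add: vec_eq_iff contract_last_def distrib_right sum.distrib)
  show "contract_last (c *\<^sub>R T) v = c *\<^sub>R contract_last T v" for c T
    by (simp add: vec_eq_iff contract_last_def sum_distrib_left mult.assoc)
qed

lemma linear_magnetic:
  assumes g: "transpose g = g" "invertible g"
  shows "linear (\<lambda>F. magnetic g e F v)"
  unfolding magnetic_def
  using linear_compose[OF linear_dual[OF g] linear_contract_last] by (simp add: comp_def)

lemma contract_last_transverse_forms:
  fixes T :: "('p::finite option, 'd::finite) tensor"
  assumes T: "antisymmetric T"
  shows "contract_last T v \<in> transverse_forms v"
  unfolding transverse_forms_iff
proof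
  show "antisymmetric (contract_last T v)"
    unfolding antisymmetric_iff_swap
  proof (intro allI impI)
    fix a b :: 'p and m :: "'p \<Rightarrow> 'd"
    assume "a \<noteq> b"
    then have "T $ case_option x (m \<circ> Transposition.transpose a b) = - T $ case_option x m" for x
      unfolding case_option_swap by (intro antisymmetric_swap[OF T]) simp
    then show "contract_last T v $ (m \<circ> Transposition.transpose a b) = - contract_last T v $ m"
      by (simp only: contract_last_def vec_lambda_beta mult_minus_left sum_negf)
  qed
  show "transverse v (contract_last T v)"
    unfolding transverse_def
  proof (intro allI)
    fix s :: 'p and m :: "'p \<Rightarrow> 'd"
    have upd: "case_option a (m(s := b)) = (case_option undefined m)(None := a, Some s := b)" for a b
      by (auto simp: fun_eq_iff split: option.split)
    have "(\<Sum>b\<in>UNIV. contract_last T v $ m(s := b) * v $ b)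
      = (\<Sum>b\<in>UNIV. \<Sum>a\<in>UNIV. T $ (case_option undefined m)(None := a, Some s := b) * v $ a * v $ b)"
      by (simp only: contract_last_def vec_lambda_beta upd sum_distrib_right)
    also have "\<dots> = (\<Sum>a\<in>UNIV. \<Sum>b\<in>UNIV. T $ (case_option undefined m)(None := a, Some s := b) * v $ a * v $ b)"
      by (rule sum.swap)
    also have "\<dots> = 0"
      by (rule antisymmetric_sum_contract[OF T]) simp
    finally show "(\<Sum>b\<in>UNIV. contract_last T v $ m(s := b) * v $ b) = 0" .
  qed
qed

lemma contract_last_transverse:
  assumes "transverse v T"
  shows "contract_last T v = 0"
proof -
  have "(\<Sum>a\<in>UNIV. T $ (case_option undefined m)(None := a) * v $ a) = 0" for m
    by (rule transverseD[OF assms])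
  moreover have "(case_option undefined m)(None := a) = case_option a m" for m :: "'b \<Rightarrow> 'a" and a
    by (auto simp: fun_eq_iff split: option.split)
  ultimately show ?thesis
    by (simp add: vec_eq_iff contract_last_def)
qed

lemma inner_triple:
  "N \<bullet> triple B x Z
    = (\<Sum>m\<in>UNIV. \<Sum>a\<in>UNIV. \<Sum>k\<in>UNIV. N $ case_sum (case_option a m) k * (B $ m * x $ a * Z $ k))"
  unfolding inner_tensor sum_fun_sum by (subst sum_fun_option) (simp add: triple_def)

lemma inner_magnetic:
  fixes F :: "('p::finite option, 'd::finite) tensor"
  assumes g: "transpose g = g" "invertible g"
  shows "G \<bullet> magnetic g e F w = (levi_civita g e \<bullet> triple G w (raise_indices g F)) / fact CARD('p option)"
  by (simp add: inner_triple inner_tensor[of G] magnetic_def contract_last_def dual_nth[OF g]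
      sum_distrib_left sum_distrib_right sum_divide_distrib ac_simps)

lemma subspace_transverse_forms: "subspace (transverse_forms v :: ('s::finite, 'd::finite) tensor set)"
proof (rule subspaceI)
  fix X Y :: "('s, 'd) tensor" and c :: real
  assume X: "X \<in> transverse_forms v" and Y: "Y \<in> transverse_forms v"
  show "X + Y \<in> transverse_forms v"
    using X Y by (simp add: transverse_forms_def antisymmetric_def distrib_left distrib_right sum.distrib)
  show "c *\<^sub>R X \<in> transverse_forms v"
    using X by (simp add: transverse_forms_def antisymmetric_def sum_distrib_left[symmetric] mult.assoc)
qed (simp add: transverse_forms_def antisymmetric_def)

text \<open>The dual of the wedge product of \<open>B\<close> and \<open>v\<close> up to a nonzero
  constant. The contracted slots form the first half of epsilon, so that pairing with
  \<open>Z\<close> is a \<open>triple\<close>.\<close>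

definition dual_wedge :: "'d::finite metric_tensor \<Rightarrow> ('p::finite option + 'p option \<Rightarrow> 'd) \<Rightarrow> real ^ 'd \<Rightarrow>
    ('p, 'd) tensor \<Rightarrow> ('p option, 'd) tensor" where
  "dual_wedge g e v B =
     (\<chi> k. \<Sum>m\<in>UNIV. \<Sum>a\<in>UNIV. levi_civita g e $ case_sum (case_option a m) k * (raise_indices g B $ m * v $ a))"

lemma inner_dual_wedge: "dual_wedge g e v B \<bullet> Z = levi_civita g e \<bullet> triple (raise_indices g B) v Z"
proof -
  have "dual_wedge g e v B \<bullet> Z = (\<Sum>k\<in>UNIV. \<Sum>m\<in>UNIV. \<Sum>a\<in>UNIV.
      levi_civita g e $ case_sum (case_option a m) k * (raise_indices g B $ m * v $ a * Z $ k))"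
    by (simp add: inner_tensor dual_wedge_def sum_distrib_right mult.assoc)
  also have "\<dots> = (\<Sum>m\<in>UNIV. \<Sum>k\<in>UNIV. \<Sum>a\<in>UNIV.
      levi_civita g e $ case_sum (case_option a m) k * (raise_indices g B $ m * v $ a * Z $ k))"
    by (rule sum.swap)
  also have "\<dots> = (\<Sum>m\<in>UNIV. \<Sum>a\<in>UNIV. \<Sum>k\<in>UNIV.
      levi_civita g e $ case_sum (case_option a m) k * (raise_indices g B $ m * v $ a * Z $ k))"
    by (rule sum.cong[OF refl], rule sum.swap)
  finally show ?thesis
    by (simp only: inner_triple)
qed

lemma linear_dual_wedge: "linear (dual_wedge g e v)"
  by (rule linearI)
    (simp_all add: vec_eq_iff dual_wedge_def change_indices_add change_indices_scaleR
      distrib_left distrib_right sum.distrib sum_distrib_left ac_simps)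

text \<open>Transversality holds because a second \<open>v\<close> meets the one already contracted
  into the antisymmetric epsilon.\<close>

lemma dual_wedge_antisymmetric_transverse:
  fixes B :: "('p::finite, 'd::finite) tensor"
  assumes N: "antisymmetric (levi_civita g e)"
  shows "antisymmetric (dual_wedge g e v B)" and "transverse v (dual_wedge g e v B)"
proof -
  show "antisymmetric (dual_wedge g e v B)"
    unfolding antisymmetric_iff_swap
  proof (intro allI impI)
    fix a b :: "'p option" and k :: "'p option \<Rightarrow> 'd"
    assume "a \<noteq> b"
    then have "levi_civita g e $ case_sum i (k \<circ> Transposition.transpose a b) = - levi_civita g e $ case_sum i k" for i
      unfolding case_sum_swap by (intro antisymmetric_swap[OF N]) simp
    then show "dual_wedge g e v B $ (k \<circ> Transposition.transpose a b) = - dual_wedge g e v B $ k"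
      by (simp only: dual_wedge_def vec_lambda_beta mult_minus_left sum_negf)
  qed
  show "transverse v (dual_wedge g e v B)"
    unfolding transverse_def
  proof (intro allI)
    fix s :: "'p option" and k :: "'p option \<Rightarrow> 'd"
    let ?h = "\<lambda>m a b. levi_civita g e $ (case_sum (case_option undefined m) k)(Inl None := a, Inr s := b) * v $ a * v $ b"
    have upd: "case_sum (case_option a m) (k(s := b))
      = (case_sum (case_option undefined m) k)(Inl None := a, Inr s := b)" for a b and m :: "'p \<Rightarrow> 'd"
      by (auto simp: fun_eq_iff split: option.split sum.split)
    have "(\<Sum>b\<in>UNIV. dual_wedge g e v B $ k(s := b) * v $ b)
      = (\<Sum>b\<in>UNIV. \<Sum>m\<in>UNIV. \<Sum>a\<in>UNIV. raise_indices g B $ m * ?h m a b)"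
      by (simp only: dual_wedge_def vec_lambda_beta upd sum_distrib_right) (simp add: ac_simps)
    also have "\<dots> = (\<Sum>m\<in>UNIV. \<Sum>b\<in>UNIV. \<Sum>a\<in>UNIV. raise_indices g B $ m * ?h m a b)"
      by (rule sum.swap)
    also have "\<dots> = (\<Sum>m\<in>UNIV. \<Sum>a\<in>UNIV. \<Sum>b\<in>UNIV. raise_indices g B $ m * ?h m a b)"
      by (rule sum.cong[OF refl], rule sum.swap)
    also have "\<dots> = (\<Sum>m\<in>UNIV. raise_indices g B $ m * (\<Sum>a\<in>UNIV. \<Sum>b\<in>UNIV. ?h m a b))"
      by (simp only: sum_distrib_left)
    also have "\<dots> = 0"
      using antisymmetric_sum_contract[OF N, of "Inl None" "Inr s"] by simp
    finally show "(\<Sum>b\<in>UNIV. dual_wedge g e v B $ k(s := b) * v $ b) = 0" .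
  qed
qed

text \<open>For injectivity, \<open>B\<close> is contracted with the magnetic part of \<open>dual_wedge g e v B\<close>, which gives
  the square of the transverse form \<open>dual_wedge g e v B\<close>.\<close>

lemma magnetic_dual_wedge_surj:
  fixes e :: "'p::finite option + 'p option \<Rightarrow> 'd::finite"
  assumes g: "lorentzian g" and v: "unit_timelike g v" and e: "bij e"
    and E: "E \<in> transverse_forms v"
  obtains B where "magnetic g e (dual_wedge g e v B) v = E"
proof -
  let ?S = "transverse_forms v :: ('p, 'd) tensor set"
  let ?J = "\<lambda>B. magnetic g e (dual_wedge g e v B) v"
  note sym = symmetric_lorentzian[OF g] and inv = invertible_lorentzian[OF g]
  have N: "volume_tensor (levi_civita g e)"
    using volume_tensor_levi_civita[OF e] inv by (simp add: invertible_det_nz)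
  then have N': "antisymmetric (levi_civita g e)"
    by (simp add: volume_tensor_def)
  have "linear ?J"
    using linear_compose[OF linear_dual_wedge linear_magnetic[OF sym inv]] by (simp add: comp_def)
  have "?J B \<in> ?S" for B
    unfolding magnetic_def by (intro contract_last_transverse_forms antisymmetric_dual sym inv e)
  moreover have "B = 0" if "B \<in> ?S" "?J B = 0" for B
  proof -
    let ?R = "dual_wedge g e v B"
    have B: "antisymmetric B" "transverse v B"
      using that(1) by (simp_all add: transverse_forms_iff)
    have "raise_indices g B \<bullet> ?J B = (?R \<bullet> raise_indices g ?R) / fact CARD('p option)"
      by (simp only: inner_magnetic[OF sym inv] inner_dual_wedge)
    then have "raise_indices g ?R \<bullet> ?R = 0"
      using that(2) by (simp add: inner_commute)
    \<comment> \<open>Positivity applies to this (p+1)-form because it is itself transverse to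
      \<open>v\<close>.\<close>
    then have "?R = 0"
      by (rule raise_positive[OF g v dual_wedge_antisymmetric_transverse(2)[OF N']])
    then have "levi_civita g e \<bullet> triple (raise_indices g B) v Z = 0" for Z
      by (simp add: inner_dual_wedge[symmetric])
    moreover have "(g *v v) \<bullet> v \<noteq> 0"
      using v by (simp add: unit_timelike_def inner_commute)
    ultimately have "raise_indices g B = 0"
      using tensor_eq_0_if_triple_eq_0[OF N transverse_raise[OF g B(2)] antisymmetric_change_indices[OF B(1)]]
      by blast
    then show ?thesis
      using lower_raise(1)[OF inv, of B] by simp
  qed
  \<comment> \<open>An injective linear map of a finite-dimensional space into itself is
    onto.\<close>
  ultimately have "?J ` ?S = ?S"
  proof (intro subspace_dim_equal)
    assume *: "\<And>B. ?J B \<in> ?S" "\<And>B. B \<in> ?S \<Longrightarrow> ?J B = 0 \<Longrightarrow> B = 0"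
    show "subspace (?J ` ?S)"
      by (rule linear_subspace_image[OF \<open>linear ?J\<close> subspace_transverse_forms])
    show "subspace ?S"
      by (rule subspace_transverse_forms)
    show "?J ` ?S \<subseteq> ?S"
      using *(1) by blast
    have "inj_on ?J ?S"
      using *(2) by (simp add: linear_inj_on_iff_eq_0[OF \<open>linear ?J\<close> subspace_transverse_forms])
    then have "inj_on ?J (span ?S)"
      by (simp add: span_eq_iff[THEN iffD2, OF subspace_transverse_forms])
    then show "dim ?S \<le> dim (?J ` ?S)"
      using dim_image_eq[OF \<open>linear ?J\<close>, of ?S] by simp
  qed
  then obtain B where "E = ?J B"
    using E by blast
  then show thesis
    using that[of B] by simp
qed

text \<open>The dual of a suitable \<open>dual_wedge\<close> has electric part \<open>E\<close>. Its
  magnetic part is corrected by a further \<open>dual_wedge\<close>, which is transverse to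
  \<open>v\<close> and so leaves the electric part alone.\<close>

lemma exists_electromagnetic:
  fixes e :: "'p::finite option + 'p option \<Rightarrow> 'd::finite"
  assumes g: "lorentzian g" and v: "unit_timelike g v" and e: "bij e"
    and E: "E \<in> transverse_forms v" and B: "B \<in> transverse_forms v"
  obtains F where "antisymmetric F" "electric F v = E" "magnetic g e F v = B"
proof -
  note sym = symmetric_lorentzian[OF g] and inv = invertible_lorentzian[OF g]
  have N: "antisymmetric (levi_civita g e)"
    using volume_tensor_levi_civita[OF e] inv by (simp add: volume_tensor_def invertible_det_nz)
  obtain B1 where B1: "magnetic g e (dual_wedge g e v B1) v = E"
    by (rule magnetic_dual_wedge_surj[OF g v e E])
  let ?F1 = "dual g e (dual_wedge g e v B1)"
  have "antisymmetric ?F1"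
    by (rule antisymmetric_dual[OF sym inv e])
  have "magnetic g e ?F1 v \<in> transverse_forms v"
    unfolding magnetic_def by (intro contract_last_transverse_forms antisymmetric_dual sym inv e)
  then have "B - magnetic g e ?F1 v \<in> transverse_forms v"
    by (rule subspace_diff[OF subspace_transverse_forms B])
  then obtain B2 where B2: "magnetic g e (dual_wedge g e v B2) v = B - magnetic g e ?F1 v"
    by (rule magnetic_dual_wedge_surj[OF g v e])
  let ?F2 = "dual_wedge g e v B2"
  note F2 = dual_wedge_antisymmetric_transverse[OF N, of v B2]
  show thesis
  proof (rule that)
    show "antisymmetric (?F1 + ?F2)"
      using \<open>antisymmetric ?F1\<close> F2(1) by (simp add: antisymmetric_def distrib_left)
    have "electric (?F1 + ?F2) v = contract_last ?F1 v + contract_last ?F2 v"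
      unfolding electric_def by (rule linear_add[OF linear_contract_last])
    then show "electric (?F1 + ?F2) v = E"
      using B1 by (simp add: contract_last_transverse[OF F2(2)] magnetic_def)
    show "magnetic g e (?F1 + ?F2) v = B"
      using B2 by (simp add: linear_add[OF linear_magnetic[OF sym inv]])
  qed
qed

subsection \<open>Derivatives on spaces of transverse forms\<close>

lemma has_derivative_along_curve:
  fixes f :: "'a::real_normed_vector \<Rightarrow> real"
  assumes f: "(f has_derivative f') (at (\<gamma> 0) within S)" and \<gamma>: "(\<gamma> has_vector_derivative Z) (at 0)"
    and T: "open T" "0 \<in> T" "\<And>t. t \<in> T \<Longrightarrow> \<gamma> t \<in> S"
  shows "((\<lambda>t. f (\<gamma> t)) has_real_derivative f' Z) (at 0)"
proof -
  have "(\<gamma> has_derivative (\<lambda>t. t *\<^sub>R Z)) (at 0 within T)"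
    using \<gamma> unfolding has_vector_derivative_def by (rule has_derivative_at_withinI)
  moreover have "(f has_derivative f') (at (\<gamma> 0) within \<gamma> ` T)"
    using has_derivative_subset[OF f] T(3) by blast
  ultimately have "((\<lambda>t. f (\<gamma> t)) has_derivative (\<lambda>t. f' (t *\<^sub>R Z))) (at 0 within T)"
    by (rule has_derivative_in_compose)
  moreover have "(\<lambda>t. f' (t *\<^sub>R Z)) = (*) (f' Z)"
    using linear_scale[OF has_derivative_linear[OF f]] by (auto simp: fun_eq_iff)
  ultimately show ?thesis
    unfolding has_field_derivative_def by (simp only: at_within_open[OF T(2,1)])
qed

text \<open>Every direction in \<open>S\<close> is the tangent of a line in \<open>S\<close> through
  \<open>x\<close>.\<close>

lemma has_derivative_subspace_unique:
  fixes f :: "'a::real_normed_vector \<Rightarrow> real"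
  assumes "(f has_derivative f1) (at x within S)" "(f has_derivative f2) (at x within S)"
    and S: "subspace S" "x \<in> S" "h \<in> S"
  shows "f1 h = f2 h"
proof -
  let ?\<gamma> = "\<lambda>t. x + t *\<^sub>R h"
  have \<gamma>: "(?\<gamma> has_vector_derivative h) (at 0)"
    by (auto intro!: derivative_eq_intros)
  have "((\<lambda>t. f (?\<gamma> t)) has_real_derivative D h) (at 0)" if "(f has_derivative D) (at x within S)" for D
    by (rule has_derivative_along_curve[OF _ \<gamma>, of _ _ S UNIV])
      (use that S in \<open>auto intro: subspace_add subspace_scale\<close>)
  then show ?thesis
    using DERIV_unique assms(1,2) by blast
qed

text \<open>The difference quotient within \<open>S\<close> evaluates the derivative only at
  \<open>y - x\<close>, which lies in \<open>S\<close>.\<close>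

lemma has_derivative_subspace_cong:
  fixes f :: "'a::real_normed_vector \<Rightarrow> real"
  assumes f: "(f has_derivative f1) (at x within S)" and "bounded_linear f2"
    and S: "subspace S" "x \<in> S" and eq: "\<And>h. h \<in> S \<Longrightarrow> f1 h = f2 h"
  shows "(f has_derivative f2) (at x within S)"
proof -
  have "\<forall>\<^sub>F y in at x within S. (1 / norm (y - x)) *\<^sub>R (f y - (f x + f1 (y - x)))
    = (1 / norm (y - x)) *\<^sub>R (f y - (f x + f2 (y - x)))"
    unfolding eventually_at_filter using eq S by (simp add: subspace_diff)
  then show ?thesis
    using f \<open>bounded_linear f2\<close> unfolding has_derivative_within by (simp only: tendsto_cong)
qed

text \<open>Riesz representation on the transverse forms: in the adapted frame their product is
  Euclidean, so the derivative is the product with a transverse form. Definiteness makes it unique,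
  and the definite description denotes it.\<close>

lemma form_derivative:
  fixes f :: "('p::finite, 'd::finite) tensor \<Rightarrow> real"
  assumes g: "lorentzian g" and v: "unit_timelike g v"
    and f: "(f has_derivative f') (at B within transverse_forms v)" and B: "B \<in> transverse_forms v"
  shows "form_derivative g v f B \<in> transverse_forms v"
    and "h \<in> transverse_forms v \<Longrightarrow> f' h = (raise_indices g h \<bullet> form_derivative g v f B) / fact CARD('p)"
proof -
  let ?S = "transverse_forms v :: ('p, 'd) tensor set"
  let ?D = "\<lambda>G h. (\<Sum>m\<in>UNIV. raise_indices g h $ m * G $ m) / fact CARD('p)"
  have D: "?D G h = (raise_indices g h \<bullet> G) / fact CARD('p)" for G h
    by (simp add: inner_tensor)
  have linD: "bounded_linear (?D G)" for G
    unfolding linear_conv_bounded_linear[symmetric] D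
    by (rule linearI) (simp_all add: change_indices_add change_indices_scaleR inner_add_left add_divide_distrib)
  obtain A :: "real ^ 'd ^ 'd" where A: "invertible A"
    "matrix_inv g = A ** transpose A + (\<chi> i j. (- 2 *\<^sub>R v) $ i * v $ j)"
    by (rule matrix_inv_lorentzian_adapted[OF g v])
  let ?C = "change_indices (transpose A) :: ('p, 'd) tensor \<Rightarrow> _"
  let ?C' = "change_indices (matrix_inv (transpose A)) :: ('p, 'd) tensor \<Rightarrow> _"
  have C: "?C' (?C X) = X" for X
  proof (rule change_indices_inverse)
    have "invertible (transpose A)"
      using A(1) by (simp add: invertible_det_nz)
    then show "matrix_inv (transpose A) ** transpose A = mat 1"
      by (rule matrix_inv_left')
  qed
  have \<phi>: "linear (\<lambda>y. f' (?C' y))"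
    using linear_compose[OF linear_change_indices has_derivative_linear[OF f]] by (simp add: comp_def)
  define z where "z = adjoint (\<lambda>y. f' (?C' y)) 1"
  have z: "f' (?C' y) = y \<bullet> z" for y
    using adjoint_works[OF \<phi>, of y 1] by (simp add: z_def)
  \<comment> \<open>The representing vector may leave the image of the transverse forms; its
    projection represents the same functional there.\<close>
  obtain y0 z0 where yz: "y0 \<in> span (?C ` ?S)" "\<And>w. w \<in> span (?C ` ?S) \<Longrightarrow> orthogonal z0 w" "z = y0 + z0"
    using orthogonal_subspace_decomp_exists by blast
  have span: "span (?C ` ?S) = ?C ` ?S"
    by (simp add: span_eq_iff linear_subspace_image[OF linear_change_indices subspace_transverse_forms])
  obtain G0 where G0: "G0 \<in> ?S" "y0 = ?C G0"
    using yz(1) span by auto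
  \<comment> \<open>The factor cancels the \<open>1 / p!\<close> in the definition of the derivative
    form.\<close>
  define G where "G = fact CARD('p) *\<^sub>R G0"
  have G: "G \<in> ?S"
    using G0(1) subspace_scale[OF subspace_transverse_forms] by (simp add: G_def)
  have repr: "f' h = ?D G h" if h: "h \<in> ?S" for h
  proof -
    have "f' h = ?C h \<bullet> z"
      using z[of "?C h"] by (simp add: C)
    also have "\<dots> = ?C h \<bullet> y0"
      using yz(2)[of "?C h"] h span by (simp add: yz(3) inner_add_right orthogonal_def inner_commute[of z0])
    also have "\<dots> = raise_indices g h \<bullet> G0"
      using h by (simp add: G0(2) inner_raise_transverse[OF A(2)] transverse_forms_iff)
    finally show ?thesis
      unfolding D by (simp add: G_def)
  qed
  have deriv: "(f has_derivative ?D G) (at B within ?S)"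
    by (rule has_derivative_subspace_cong[OF f linD subspace_transverse_forms B repr])
  have "form_derivative g v f B = G"
    unfolding form_derivative_def
  proof (rule the_equality)
    show "G \<in> ?S \<and> (f has_derivative ?D G) (at B within ?S)"
      using G deriv by blast
    fix G'
    assume G': "G' \<in> ?S \<and> (f has_derivative ?D G') (at B within ?S)"
    let ?h = "G' - G"
    have h: "?h \<in> ?S"
      using G G' subspace_diff[OF subspace_transverse_forms] by blast
    have "?D G' ?h = ?D G ?h"
      using has_derivative_subspace_unique[OF _ deriv subspace_transverse_forms B h] G' by blast
    then have "raise_indices g ?h \<bullet> ?h = 0"
      by (simp add: D inner_diff_right)
    then have "?h = 0"
      using h raise_positive[OF g v, of ?h] by (simp only: transverse_forms_iff)
    then show "G' = G"
      by simp
  qed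
  then show "form_derivative g v f B \<in> ?S"
    and "h \<in> ?S \<Longrightarrow> f' h = (raise_indices g h \<bullet> form_derivative g v f B) / fact CARD('p)"
    using G repr D by simp_all
qed

subsection \<open>Invariance of scalar functions under isometries\<close>

lemma sum_PiE_insert:
  fixes f :: "('i \<Rightarrow> 'd::finite) \<Rightarrow> real"
  assumes "a \<notin> D"
  shows "(\<Sum>k \<in> insert a D \<rightarrow>\<^sub>E UNIV. f k) = (\<Sum>y\<in>UNIV. \<Sum>k \<in> D \<rightarrow>\<^sub>E UNIV. f (k(a := y)))"
proof -
  have "(\<Sum>k \<in> insert a D \<rightarrow>\<^sub>E UNIV. f k) = (\<Sum>z\<in>UNIV \<times> (D \<rightarrow>\<^sub>E UNIV). f ((\<lambda>(y, k). k(a := y)) z))"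
    unfolding PiE_insert_eq
    by (subst sum.reindex[OF inj_combinator[OF assms]]) (simp add: comp_def)
  then show ?thesis
    by (simp add: sum.cartesian_product case_prod_unfold)
qed

text \<open>Distinct pairs involve disjoint slots, so the sum over all index assignments
  factorizes.\<close>

lemma sum_PiE_pairs:
  fixes h :: "'i \<times> 'i \<Rightarrow> 'd::finite \<Rightarrow> 'd \<Rightarrow> real"
  assumes "finite P" "inj_on fst P" "inj_on snd P" "fst ` P \<inter> snd ` P = {}"
  shows "(\<Sum>k \<in> (fst ` P \<union> snd ` P) \<rightarrow>\<^sub>E UNIV. \<Prod>p\<in>P. h p (k (fst p)) (k (snd p)))
    = (\<Prod>p\<in>P. \<Sum>x\<in>UNIV. \<Sum>y\<in>UNIV. h p x y)"
  using assms
proof (induction P rule: finite_induct)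
  case (insert p P)
  obtain a b where p: "p = (a, b)"
    by (cases p)
  let ?D = "fst ` P \<union> snd ` P"
  let ?f = "\<lambda>k. \<Prod>p\<in>P. h p (k (fst p)) (k (snd p))"
  have a: "a \<notin> insert b ?D" and b: "b \<notin> ?D"
    using insert.prems insert.hyps by (auto simp: p)
  have f: "?f (k(b := y, a := x)) = ?f k" for k x y
  proof (rule prod.cong[OF refl])
    fix q
    assume "q \<in> P"
    then have "fst q \<in> ?D" "snd q \<in> ?D"
      by simp_all
    then have "fst q \<noteq> a" "fst q \<noteq> b" "snd q \<noteq> a" "snd q \<noteq> b"
      using a b by blast+
    then show "h q ((k(b := y, a := x)) (fst q)) ((k(b := y, a := x)) (snd q)) = h q (k (fst q)) (k (snd q))"
      by simp
  qed
  have IH: "(\<Sum>k \<in> ?D \<rightarrow>\<^sub>E UNIV. ?f k) = (\<Prod>p\<in>P. \<Sum>x\<in>UNIV. \<Sum>y\<in>UNIV. h p x y)"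
    using insert.prems by (intro insert.IH) (auto simp: inj_on_def)
  have "(\<Sum>k \<in> insert a (insert b ?D) \<rightarrow>\<^sub>E UNIV. h p (k a) (k b) * ?f k)
    = (\<Sum>x\<in>UNIV. \<Sum>y\<in>UNIV. \<Sum>k \<in> ?D \<rightarrow>\<^sub>E UNIV. h p x y * ?f k)"
    unfolding sum_PiE_insert[OF a] sum_PiE_insert[OF b] f using a by auto
  also have "\<dots> = (\<Sum>x\<in>UNIV. \<Sum>y\<in>UNIV. h p x y) * (\<Sum>k \<in> ?D \<rightarrow>\<^sub>E UNIV. ?f k)"
    by (simp add: sum_distrib_left[symmetric] sum_distrib_right)
  also have "insert a (insert b ?D) = fst ` insert p P \<union> snd ` insert p P"
    by (auto simp: p)
  finally show ?case
    using insert.hyps by (simp add: IH p)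
qed simp

lemma prod_complete_pairing:
  fixes f :: "nat \<times> 'p::finite \<Rightarrow> real"
  assumes P: "complete_pairing m P"
  shows "(\<Prod>i<m. \<Prod>s\<in>UNIV. f (i, s)) = (\<Prod>p\<in>P. f (fst p) * f (snd p))"
proof -
  have P': "inj_on fst P" "inj_on snd P" "fst ` P \<inter> snd ` P = {}" "fst ` P \<union> snd ` P = {..<m} \<times> UNIV"
    using P by (simp_all add: complete_pairing_def)
  then have fin: "finite (fst ` P)" "finite (snd ` P)"
    by (metis finite_Un finite_SigmaI finite_lessThan finite)+
  have "(\<Prod>i<m. \<Prod>s\<in>UNIV. f (i, s)) = (\<Prod>x \<in> fst ` P \<union> snd ` P. f x)"
    by (simp add: P'(4) prod.cartesian_product)
  also have "\<dots> = (\<Prod>x \<in> fst ` P. f x) * (\<Prod>x \<in> snd ` P. f x)"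
    by (rule prod.union_disjoint[OF fin P'(3)])
  finally show ?thesis
    by (simp add: prod.reindex P'(1,2) prod.distrib)
qed

lemma sum_PiE_curry:
  fixes f :: "(nat \<Rightarrow> 'p::finite \<Rightarrow> 'd::finite) \<Rightarrow> real"
  assumes "\<And>J J'. (\<And>i. i < m \<Longrightarrow> J i = J' i) \<Longrightarrow> f J = f J'"
  shows "(\<Sum>J \<in> {..<m} \<rightarrow>\<^sub>E UNIV. f J) = (\<Sum>j \<in> ({..<m} \<times> UNIV) \<rightarrow>\<^sub>E UNIV. f (\<lambda>i s. j (i, s)))"
  by (rule sum.reindex_bij_witness[where j = "\<lambda>J. \<lambda>x\<in>{..<m} \<times> UNIV. J (fst x) (snd x)"
        and i = "\<lambda>j. \<lambda>i\<in>{..<m}. \<lambda>s. j (i, s)"])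
    (auto simp: PiE_iff extensional_def fun_eq_iff intro!: assms)

text \<open>Each slot of each copy of \<open>B\<close> contributes a factor \<open>L\<close>.
  Summing over the outer indices first, every pair combines two of them with the inverse metric into
  \<open>L ** matrix_inv g ** transpose L\<close>.\<close>

lemma contraction_isometry:
  fixes B :: "('p::finite, 'd::finite) tensor"
  assumes L: "isometry g L" and P: "complete_pairing m P"
  shows "contraction g (change_indices (transpose L) B) m P = contraction g B m P"
proof -
  let ?K = "({..<m} \<times> (UNIV :: 'p set)) \<rightarrow>\<^sub>E (UNIV :: 'd set)"
  let ?M = "matrix_inv g"
  have P': "inj_on fst P" "inj_on snd P" "fst ` P \<inter> snd ` P = {}" "fst ` P \<union> snd ` P = {..<m} \<times> UNIV"
    using P by (simp_all add: complete_pairing_def)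
  then have "finite P"
    by (metis finite_Un finite_SigmaI finite_imageD finite_lessThan finite)
  have expand: "(\<Prod>i<m. change_indices (transpose L) B $ (\<lambda>s. k (i, s)))
    = (\<Sum>j\<in>?K. (\<Prod>p\<in>P. L $ j (fst p) $ k (fst p) * L $ j (snd p) $ k (snd p)) * (\<Prod>i<m. B $ (\<lambda>s. j (i, s))))"
    for k :: "nat \<times> 'p \<Rightarrow> 'd"
  proof -
    have "(\<Prod>i<m. change_indices (transpose L) B $ (\<lambda>s. k (i, s)))
      = (\<Prod>i<m. \<Sum>q\<in>UNIV. (\<Prod>s\<in>UNIV. L $ q s $ k (i, s)) * B $ q)"
      by (simp add: change_indices_nth transpose_def)
    also have "\<dots> = (\<Sum>J \<in> {..<m} \<rightarrow>\<^sub>E UNIV. \<Prod>i<m. (\<Prod>s\<in>UNIV. L $ J i s $ k (i, s)) * B $ J i)"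
      by (rule prod_sum_PiE) simp_all
    also have "\<dots> = (\<Sum>j\<in>?K. \<Prod>i<m. (\<Prod>s\<in>UNIV. L $ j (i, s) $ k (i, s)) * B $ (\<lambda>s. j (i, s)))"
      by (rule sum_PiE_curry) simp
    finally show ?thesis
      by (simp add: prod.distrib prod_complete_pairing[OF P, of "\<lambda>x. L $ j x $ k x" for j])
  qed
  have pairs: "(\<Sum>k\<in>?K. \<Prod>p\<in>P. L $ j (fst p) $ k (fst p) * L $ j (snd p) $ k (snd p) * ?M $ k (fst p) $ k (snd p))
    = (\<Prod>p\<in>P. ?M $ j (fst p) $ j (snd p))" for j :: "nat \<times> 'p \<Rightarrow> 'd"
  proof -
    have "(\<Sum>x\<in>UNIV. \<Sum>y\<in>UNIV. L $ a $ x * L $ b $ y * ?M $ x $ y) = ?M $ a $ b" for a b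
    proof -
      have "(\<Sum>x\<in>UNIV. \<Sum>y\<in>UNIV. L $ a $ x * L $ b $ y * ?M $ x $ y) = (L ** ?M ** transpose L) $ a $ b"
        unfolding matrix_matrix_mult_def transpose_def
        by (subst sum.swap) (simp add: sum_distrib_left sum_distrib_right ac_simps)
      then show ?thesis
        using L by (simp add: isometry_def)
    qed
    then show ?thesis
      using sum_PiE_pairs[OF \<open>finite P\<close> P'(1-3),
          of "\<lambda>p x y. L $ j (fst p) $ x * L $ j (snd p) $ y * ?M $ x $ y"]
      by (simp add: P'(4))
  qed
  have "contraction g (change_indices (transpose L) B) m P
    = (\<Sum>k\<in>?K. \<Sum>j\<in>?K. (\<Prod>i<m. B $ (\<lambda>s. j (i, s))) *
        (\<Prod>p\<in>P. L $ j (fst p) $ k (fst p) * L $ j (snd p) $ k (snd p) * ?M $ k (fst p) $ k (snd p)))"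
    unfolding contraction_def expand
    by (simp add: sum_distrib_left sum_distrib_right prod.distrib case_prod_unfold ac_simps)
  also have "\<dots> = (\<Sum>j\<in>?K. \<Sum>k\<in>?K. (\<Prod>i<m. B $ (\<lambda>s. j (i, s))) *
        (\<Prod>p\<in>P. L $ j (fst p) $ k (fst p) * L $ j (snd p) $ k (snd p) * ?M $ k (fst p) $ k (snd p)))"
    by (rule sum.swap)
  also have "\<dots> = contraction g B m P"
    by (simp only: sum_distrib_left[symmetric] pairs contraction_def case_prod_unfold)
  finally show ?thesis .
qed

text \<open>One and the same \<open>\<Phi>\<close> serves all observers, so values on forms
  transverse to different observers can be compared.\<close>

lemma scalar_function_isometry:
  assumes f: "scalar_function f" and g: "lorentzian g" and L: "isometry g L"
    and u: "unit_timelike g u" "B \<in> transverse_forms u"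
    and v: "unit_timelike g v" "change_indices (transpose L) B \<in> transverse_forms v"
  shows "f g (change_indices (transpose L) B) = f g B"
proof -
  obtain \<Phi> where \<Phi>: "\<And>g v B. lorentzian g \<Longrightarrow> unit_timelike g v \<Longrightarrow> B \<in> transverse_forms v \<Longrightarrow>
      f g B = \<Phi> (\<lambda>m P. if complete_pairing m P then contraction g B m P else 0)"
    using f unfolding scalar_function_def by blast
  have "(\<lambda>m P. if complete_pairing m P then contraction g (change_indices (transpose L) B) m P else 0)
    = (\<lambda>m P. if complete_pairing m P then contraction g B m P else 0)"
    by (intro ext) (simp add: contraction_isometry[OF L])
  then show ?thesis
    by (simp only: \<Phi>[OF g u] \<Phi>[OF g v])
qed

lemma transverse_scaleR: "c \<noteq> 0 \<Longrightarrow> transverse (c *\<^sub>R u) B \<longleftrightarrow> transverse u B"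
  by (simp add: transverse_def mult.left_commute[of _ c] sum_distrib_left[symmetric])

lemma transverse_forms_isometry:
  assumes "B \<in> transverse_forms u" "L *v v = u"
  shows "change_indices (transpose L) B \<in> transverse_forms v"
  using assms transverse_change_indices[of "transpose L" v B] antisymmetric_change_indices[of B "transpose L"]
  by (simp add: transverse_forms_iff del: transpose_matrix_vector)

subsection \<open>The variation of the observer\<close>

text \<open>At the identity, the product rule leaves Kronecker deltas in all slots except the
  differentiated one.\<close>

lemma sum_slot_delta:
  fixes f :: "('s::finite \<Rightarrow> 'd::finite) \<Rightarrow> real"
  shows "(\<Sum>k\<in>UNIV. (\<Prod>s'\<in>UNIV - {s}. if k s' = m s' then 1 else 0) * f k) = (\<Sum>a\<in>UNIV. f (m(s := a)))"
proof -
  have "(\<Prod>s'\<in>UNIV - {s}. if k s' = m s' then 1 else 0 :: real) = 0"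
    if k: "k \<notin> range (\<lambda>a. m(s := a))" for k
  proof -
    have "\<exists>s'. s' \<noteq> s \<and> k s' \<noteq> m s'"
    proof (rule ccontr)
      assume "\<not> ?thesis"
      then have "k = m(s := k s)"
        by (auto simp: fun_eq_iff)
      then show False
        using k by blast
    qed
    then show ?thesis
      by (auto intro!: prod_zero)
  qed
  then have "(\<Sum>k\<in>UNIV. (\<Prod>s'\<in>UNIV - {s}. if k s' = m s' then 1 else 0) * f k)
    = (\<Sum>k\<in>range (\<lambda>a. m(s := a)). (\<Prod>s'\<in>UNIV - {s}. if k s' = m s' then 1 else 0) * f k)"
    by (intro sum.mono_neutral_right) auto
  also have "\<dots> = (\<Sum>a\<in>UNIV. f (m(s := a)))"
  proof (subst sum.reindex)
    show "inj (\<lambda>a. m(s := a))"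
      by (metis fun_upd_same injI)
    have "(\<Prod>s'\<in>UNIV - {s}. if (m(s := a)) s' = m s' then 1 else 0 :: real) = 1" for a
      by (rule prod.neutral) simp
    then show "sum ((\<lambda>k. (\<Prod>s'\<in>UNIV - {s}. if k s' = m s' then 1 else 0) * f k) \<circ> (\<lambda>a. m(s := a))) UNIV
      = (\<Sum>a\<in>UNIV. f (m(s := a)))"
      by simp
  qed
  finally show ?thesis .
qed

text \<open>Product rule at the identity: besides \<open>X\<close> there is the infinitesimal action
  of \<open>\<Lambda>\<close> on \<open>B\<close>, one slot at a time.\<close>

lemma has_vector_derivative_change_indices:
  fixes B X :: "('s::finite, 'd::finite) tensor"
  assumes L: "\<And>i j. ((\<lambda>t. L t $ i $ j) has_real_derivative \<Lambda> $ i $ j) (at 0)" and L0: "L 0 = mat 1"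
  shows "((\<lambda>t. change_indices (transpose (L t)) (B + t *\<^sub>R X)) has_vector_derivative
    (X + (\<chi> m. \<Sum>s\<in>UNIV. \<Sum>a\<in>UNIV. \<Lambda> $ a $ m s * B $ m(s := a)))) (at 0)"
proof -
  let ?Z = "X + (\<chi> m. \<Sum>s\<in>UNIV. \<Sum>a\<in>UNIV. \<Lambda> $ a $ m s * B $ m(s := a))"
  have comp: "((\<lambda>t. change_indices (transpose (L t)) (B + t *\<^sub>R X) $ m) has_real_derivative ?Z $ m) (at 0)" for m
  proof -
    have "((\<lambda>t. \<Prod>s\<in>UNIV. L t $ k s $ m s) has_real_derivative
      (\<Sum>s\<in>UNIV. \<Lambda> $ k s $ m s * (\<Prod>s'\<in>UNIV - {s}. L 0 $ k s' $ m s'))) (at 0)" for k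
      by (rule has_field_derivative_prod) (rule L)
    then have "((\<lambda>t. \<Sum>k\<in>UNIV. (\<Prod>s\<in>UNIV. L t $ k s $ m s) * (B $ k + t * X $ k)) has_real_derivative
      (\<Sum>k\<in>UNIV. (\<Sum>s\<in>UNIV. \<Lambda> $ k s $ m s * (\<Prod>s'\<in>UNIV - {s}. L 0 $ k s' $ m s')) * (B $ k + 0 * X $ k)
        + (\<Prod>s\<in>UNIV. L 0 $ k s $ m s) * X $ k)) (at 0)"
      by (auto intro!: derivative_eq_intros simp: mult.commute add.commute)
    moreover have "(\<Sum>k\<in>UNIV. (\<Sum>s\<in>UNIV. \<Lambda> $ k s $ m s * (\<Prod>s'\<in>UNIV - {s}. L 0 $ k s' $ m s')) * (B $ k + 0 * X $ k)
        + (\<Prod>s\<in>UNIV. L 0 $ k s $ m s) * X $ k) = ?Z $ m"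
    proof -
      have 1: "(\<Sum>k\<in>UNIV. (\<Prod>s\<in>UNIV. L 0 $ k s $ m s) * X $ k) = X $ m"
      proof -
        have "(\<Prod>s\<in>UNIV. L 0 $ k s $ m s) = (\<Prod>s\<in>UNIV. (mat 1 :: real ^ 'd ^ 'd) $ m s $ k s)" for k
          by (intro prod.cong refl) (auto simp: L0 mat_def)
        moreover have "change_indices (mat 1) X $ m = X $ m"
          by simp
        ultimately show ?thesis
          by (simp only: change_indices_nth)
      qed
      have "(\<Sum>k\<in>UNIV. (\<Sum>s\<in>UNIV. \<Lambda> $ k s $ m s * (\<Prod>s'\<in>UNIV - {s}. L 0 $ k s' $ m s')) * B $ k)
        = (\<Sum>k\<in>UNIV. \<Sum>s\<in>UNIV. (\<Prod>s'\<in>UNIV - {s}. if k s' = m s' then 1 else 0) * (\<Lambda> $ k s $ m s * B $ k))"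
        by (simp add: L0 mat_def sum_distrib_left sum_distrib_right ac_simps)
      also have "\<dots> = (\<Sum>s\<in>UNIV. \<Sum>k\<in>UNIV. (\<Prod>s'\<in>UNIV - {s}. if k s' = m s' then 1 else 0) * (\<Lambda> $ k s $ m s * B $ k))"
        by (rule sum.swap)
      also have "\<dots> = (\<Sum>s\<in>UNIV. \<Sum>a\<in>UNIV. \<Lambda> $ a $ m s * B $ m(s := a))"
        by (simp add: sum_slot_delta)
      finally show ?thesis
        by (simp add: sum.distrib 1)
    qed
    ultimately show ?thesis
      by (simp add: change_indices_nth transpose_def)
  qed
  show ?thesis
    unfolding has_vector_derivative_def
  proof (subst has_derivative_componentwise_within, rule ballI)
    fix b :: "('s, 'd) tensor"
    assume "b \<in> Basis"
    then obtain m where b: "b = axis m 1"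
      by (auto simp: Basis_vec_def)
    show "((\<lambda>t. change_indices (transpose (L t)) (B + t *\<^sub>R X) \<bullet> b) has_derivative (\<lambda>t. (t *\<^sub>R ?Z) \<bullet> b)) (at 0)"
    proof -
      have "(\<lambda>t. (t *\<^sub>R ?Z) \<bullet> b) = (*) (?Z $ m)"
        by (simp only: fun_eq_iff b inner_axis vector_scaleR_component) simp
      then show ?thesis
        using comp[of m] by (simp only: has_field_derivative_def) (simp add: b inner_axis)
    qed
  qed
qed

text \<open>If \<open>z\<close> is the part of \<open>Z\<close> orthogonal to \<open>S\<close>, the
  curve has product 0 with \<open>z\<close> near 0; so does \<open>Z\<close>, and
  \<open>z = 0\<close>.\<close>

lemma vector_derivative_in_subspace:
  fixes \<gamma> :: "real \<Rightarrow> 'a::euclidean_space"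
  assumes \<gamma>: "(\<gamma> has_vector_derivative Z) (at 0)" and S: "subspace S"
    and T: "open T" "0 \<in> T" "\<And>t. t \<in> T \<Longrightarrow> \<gamma> t \<in> S"
  shows "Z \<in> S"
proof -
  obtain y z where yz: "y \<in> span S" "\<And>w. w \<in> span S \<Longrightarrow> orthogonal z w" "Z = y + z"
    using orthogonal_subspace_decomp_exists by blast
  have "((\<lambda>t. \<gamma> t \<bullet> z) has_real_derivative Z \<bullet> z) (at 0)"
  proof -
    have "((\<lambda>t. \<gamma> t \<bullet> z) has_derivative (\<lambda>t. (t *\<^sub>R Z) \<bullet> z)) (at 0)"
      using \<gamma> unfolding has_vector_derivative_def by (rule has_derivative_inner_left)
    moreover have "(\<lambda>t. (t *\<^sub>R Z) \<bullet> z) = (*) (Z \<bullet> z)"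
      by (simp add: fun_eq_iff)
    ultimately show ?thesis
      by (simp only: has_field_derivative_def)
  qed
  moreover have "\<gamma> t \<bullet> z = 0" if "t \<in> T" for t
    using yz(2)[OF span_base[OF T(3)[OF that]]] by (simp add: orthogonal_def inner_commute)
  then have "((\<lambda>t. \<gamma> t \<bullet> z) has_real_derivative 0) (at 0)"
    by (intro has_field_derivative_transform_within_open[OF DERIV_const[of 0] T(1,2)]) simp
  ultimately have "Z \<bullet> z = 0"
    by (rule DERIV_unique)
  then have "z = 0"
    using yz(2)[OF yz(1)] by (simp add: yz(3) inner_add_left orthogonal_def inner_commute[of z y])
  then show ?thesis
    using yz(1,3) S by (simp add: span_eq_iff[THEN iffD2])
qed

lemma boost_curve:
  fixes g :: "'d::finite metric_tensor"
  assumes g: "lorentzian g" and v: "unit_timelike g v" and w: "v \<bullet> (g *v w) = 0"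
  obtains T u where "open T" "0 \<in> T"
    "\<And>t. t \<in> T \<Longrightarrow> unit_timelike g (u t)" "\<And>t. t \<in> T \<Longrightarrow> u t \<bullet> (g *v v) \<noteq> 1"
    "\<And>t. t \<in> T \<Longrightarrow> \<exists>c. c \<noteq> 0 \<and> u t = c *\<^sub>R (v + t *\<^sub>R w)"
    "boost g v (u 0) = mat 1"
    "\<And>i j. ((\<lambda>t. boost g v (u t) $ i $ j) has_real_derivative
      v $ i * (g *v w) $ j - w $ i * (g *v v) $ j) (at 0)"
proof -
  note sym = symmetric_lorentzian[OF g]
  define W where "W = w \<bullet> (g *v w)"
  \<comment> \<open>The square of \<open>v + t w\<close> is \<open>- (1 - t\<^sup>2 * W)\<close>;
    \<open>r\<close> normalizes it, and \<open>T\<close> is where it stays timelike.\<close>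
  define r where "r t = 1 / sqrt (1 - t\<^sup>2 * W)" for t
  define u where "u t = r t *\<^sub>R (v + t *\<^sub>R w)" for t
  define T where "T = {t. t\<^sup>2 * W < 1}"
  have vv: "v \<bullet> (g *v v) = - 1"
    using v by (simp add: unit_timelike_def)
  have wv: "w \<bullet> (g *v v) = 0"
    using w ginner_commute[OF sym, of w v] by simp
  have r_pos: "r t > 0" if "t \<in> T" for t
    using that by (simp add: r_def T_def)
  have r_sq: "r t * r t * (1 - t\<^sup>2 * W) = 1" if "t \<in> T" for t
    using that by (simp add: r_def T_def field_simps)
  have r0: "r 0 = 1"
    by (simp add: r_def)
  \<comment> \<open>\<open>r\<close> depends on \<open>t\<close> only through its square.\<close>
  have r': "(r has_real_derivative 0) (at 0)"
    unfolding r_def by (auto intro!: derivative_eq_intros)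
  have uv: "u t \<bullet> (g *v v) = - r t" for t
    by (simp add: u_def inner_add_left vv wv)
  have gu: "g *v u t = r t *\<^sub>R (g *v v + t *\<^sub>R (g *v w))" for t
    by (simp add: u_def matrix_vector_mult_scaleR matrix_vector_right_distrib)
  show thesis
  proof (rule that)
    show "open T"
      unfolding T_def by (intro open_Collect_less continuous_intros)
    show "0 \<in> T"
      by (simp add: T_def)
    show "unit_timelike g (u t)" if "t \<in> T" for t
    proof -
      have "u t \<bullet> (g *v u t) = - (r t * r t * (1 - t\<^sup>2 * W))"
        by (simp add: gu) (simp add: u_def inner_add_left inner_add_right vv wv w W_def algebra_simps power2_eq_square)
      then show ?thesis
        using r_sq[OF that] by (simp add: unit_timelike_def)
    qed
    show "u t \<bullet> (g *v v) \<noteq> 1" if "t \<in> T" for t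
      using r_pos[OF that] by (simp add: uv)
    show "\<exists>c. c \<noteq> 0 \<and> u t = c *\<^sub>R (v + t *\<^sub>R w)" if "t \<in> T" for t
      using r_pos[OF that] by (intro exI[of _ "r t"]) (simp add: u_def)
    have entries: "boost g v (u t) $ i $ j = (if i = j then 1 else 0)
      - (v $ i + r t * (v $ i + t * w $ i)) * ((g *v v) $ j + r t * ((g *v v) $ j + t * (g *v w) $ j)) / (- r t - 1)
      - 2 * (r t * (v $ i + t * w $ i)) * (g *v v) $ j" for t i j
      by (simp add: boost_def uv matrix_vector_right_distrib gu) (simp add: u_def)
    show "boost g v (u 0) = mat 1"
      unfolding vec_eq_iff entries by (simp add: r0 mat_def field_simps)
    \<comment> \<open>This generator sends \<open>v\<close> to \<open>w\<close>, the initial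
      velocity of \<open>u\<close>.\<close>
    show "((\<lambda>t. boost g v (u t) $ i $ j) has_real_derivative
      v $ i * (g *v w) $ j - w $ i * (g *v v) $ j) (at 0)" for i j
      unfolding entries
      by (auto intro!: derivative_eq_intros r' simp: r0 field_simps)
  qed
qed

text \<open>In each term of the boost generator either \<open>v\<close> is contracted into
  \<open>B\<close> or \<open>\<alpha>\<close> into \<open>G\<close>.\<close>

lemma inner_rotation_zero:
  fixes B G :: "('p::finite, 'd::finite) tensor"
  assumes B: "transverse v B" and G: "transverse \<alpha> G"
  shows "G \<bullet> (\<chi> m. \<Sum>s\<in>UNIV. \<Sum>a\<in>UNIV. (v $ a * \<beta> $ m s - w $ a * \<alpha> $ m s) * B $ m(s := a)) = 0"
proof -
  let ?C = "\<lambda>s m. \<Sum>a\<in>UNIV. w $ a * B $ m(s := a)"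
  have "(\<Sum>a\<in>UNIV. (v $ a * \<beta> $ m s - w $ a * \<alpha> $ m s) * B $ m(s := a)) = - (\<alpha> $ m s * ?C s m)" for m s
  proof -
    have "(\<Sum>a\<in>UNIV. (v $ a * \<beta> $ m s - w $ a * \<alpha> $ m s) * B $ m(s := a))
      = \<beta> $ m s * (\<Sum>a\<in>UNIV. B $ m(s := a) * v $ a) - \<alpha> $ m s * ?C s m"
      by (simp add: algebra_simps sum_subtractf sum_distrib_left)
    then show ?thesis
      by (simp add: transverseD[OF B])
  qed
  then have "G \<bullet> (\<chi> m. \<Sum>s\<in>UNIV. \<Sum>a\<in>UNIV. (v $ a * \<beta> $ m s - w $ a * \<alpha> $ m s) * B $ m(s := a))
    = - (\<Sum>m\<in>UNIV. \<Sum>s\<in>UNIV. G $ m * (\<alpha> $ m s * ?C s m))"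
    by (simp add: inner_tensor sum_negf sum_distrib_left[of "G $ _"])
  also have "(\<Sum>m\<in>UNIV. \<Sum>s\<in>UNIV. G $ m * (\<alpha> $ m s * ?C s m))
    = (\<Sum>s\<in>UNIV. \<Sum>m\<in>UNIV. G $ m * (\<alpha> $ m s * ?C s m))"
    by (rule sum.swap)
  also have "\<dots> = 0"
  proof (rule sum.neutral, rule ballI)
    fix s
    show "(\<Sum>m\<in>UNIV. G $ m * (\<alpha> $ m s * ?C s m)) = 0"
    proof (rule sum_fun_slot_zero[where s = s])
      fix m :: "'p \<Rightarrow> 'd"
      have "(\<Sum>b\<in>UNIV. G $ m(s := b) * (\<alpha> $ (m(s := b)) s * ?C s (m(s := b))))
        = (\<Sum>b\<in>UNIV. G $ m(s := b) * \<alpha> $ b) * ?C s m"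
        by (simp add: sum_distrib_right mult.assoc)
      then show "(\<Sum>b\<in>UNIV. G $ m(s := b) * (\<alpha> $ (m(s := b)) s * ?C s (m(s := b)))) = 0"
        by (simp add: transverseD[OF G])
    qed
  qed
  finally show ?thesis
    by (simp only: minus_zero)
qed

lemma smooth_scalar_function_has_derivative:
  assumes "smooth_scalar_function f" "lorentzian g" "unit_timelike g v" "B \<in> transverse_forms v"
  obtains f' where "(f g has_derivative f') (at B within transverse_forms v)"
proof -
  have "C_k_on (Suc 0) (transverse_forms v) (f g)"
    using assms(1-3) unfolding smooth_scalar_function_def smooth_on_subspace_def by blast
  then show thesis
    using that assms(4) by auto
qed

text \<open>Boosting \<open>v + t w\<close> back to \<open>v\<close> is an isometry, so that \<open>f\<close> can be differentiated
  along a curve in the fixed space of forms transverse to \<open>v\<close>. The boost itself does not contribute,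
  because the derivative form is transverse.\<close>

lemma has_v_variation_iff:
  fixes e :: "'p::finite option + 'p option \<Rightarrow> 'd::finite"
  assumes g: "lorentzian g" and e: "bij e" and f: "smooth_scalar_function f"
    and F: "antisymmetric F" and v: "unit_timelike g v" and \<delta>v: "v \<bullet> \<delta>v = 0"
  shows "has_v_variation g e f F v \<delta>v D \<longleftrightarrow>
    D = (raise_indices g (form_derivative g v (f g) (magnetic g e F v)) \<bullet>
      magnetic g e F (matrix_inv g *v \<delta>v)) / fact CARD('p)"
proof -
  note sym = symmetric_lorentzian[OF g] and inv = invertible_lorentzian[OF g]
  define w where "w = matrix_inv g *v \<delta>v"
  define B where "B = magnetic g e F v"
  define X where "X = magnetic g e F w"
  define G where "G = form_derivative g v (f g) B"
  have dual: "antisymmetric (dual g e F)"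
    by (rule antisymmetric_dual[OF sym inv e])
  have B_t: "magnetic g e F (v + t *\<^sub>R w) = B + t *\<^sub>R X" for t
    by (simp add: B_def X_def magnetic_def contract_last_def vec_eq_iff distrib_left sum.distrib
        sum_distrib_left ac_simps)
  have B: "B \<in> transverse_forms v"
    unfolding B_def magnetic_def by (rule contract_last_transverse_forms[OF dual])
  have "g *v w = \<delta>v"
    by (simp add: w_def matrix_vector_mul_assoc matrix_inv_right'[OF inv])
  then have w: "v \<bullet> (g *v w) = 0"
    using \<delta>v by simp
  obtain T u where T: "open T" "0 \<in> T"
    and u: "\<And>t. t \<in> T \<Longrightarrow> unit_timelike g (u t)" "\<And>t. t \<in> T \<Longrightarrow> u t \<bullet> (g *v v) \<noteq> 1"
      "\<And>t. t \<in> T \<Longrightarrow> \<exists>c. c \<noteq> 0 \<and> u t = c *\<^sub>R (v + t *\<^sub>R w)"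
    and L0: "boost g v (u 0) = mat 1"
    and L': "\<And>i j. ((\<lambda>t. boost g v (u t) $ i $ j) has_real_derivative
      v $ i * (g *v w) $ j - w $ i * (g *v v) $ j) (at 0)"
    by (rule boost_curve[OF g v w]) blast
  define \<gamma> where "\<gamma> t = change_indices (transpose (boost g v (u t))) (B + t *\<^sub>R X)" for t
  define R :: "('p, 'd) tensor" where
    "R = (\<chi> m. \<Sum>s\<in>UNIV. \<Sum>a\<in>UNIV. (v $ a * (g *v w) $ m s - w $ a * (g *v v) $ m s) * B $ m(s := a))"
  have \<gamma>': "(\<gamma> has_vector_derivative X + R) (at 0)"
    unfolding \<gamma>_def R_def
    using has_vector_derivative_change_indices[of "\<lambda>t. boost g v (u t)"
        "\<chi> i j. v $ i * (g *v w) $ j - w $ i * (g *v v) $ j" B X] L' L0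
    by simp
  have "\<gamma> 0 = B"
    by (simp add: \<gamma>_def L0 transpose_mat)
  have \<gamma>: "\<gamma> t \<in> transverse_forms v" "f g (\<gamma> t) = f g (B + t *\<^sub>R X)" if t: "t \<in> T" for t
  proof -
    note L = boost_isometry[OF g v u(1,2)[OF t]]
    obtain c where c: "c \<noteq> 0" "u t = c *\<^sub>R (v + t *\<^sub>R w)"
      using u(3)[OF t] by blast
    \<comment> \<open>Transversality is insensitive to the length of the observer vector, so the
      unnormalized \<open>v + t w\<close> may be replaced by \<open>u t\<close>.\<close>
    have "B + t *\<^sub>R X \<in> transverse_forms (v + t *\<^sub>R w)"
      unfolding B_t[symmetric] magnetic_def by (rule contract_last_transverse_forms[OF dual])
    then have BX: "B + t *\<^sub>R X \<in> transverse_forms (u t)"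
      unfolding c(2) transverse_forms_iff transverse_scaleR[OF c(1)] .
    show "\<gamma> t \<in> transverse_forms v"
      unfolding \<gamma>_def by (rule transverse_forms_isometry[OF BX L(2)])
    then show "f g (\<gamma> t) = f g (B + t *\<^sub>R X)"
      unfolding \<gamma>_def using f
      by (intro scalar_function_isometry[OF _ g L(1) u(1)[OF t] BX v]) (simp_all add: smooth_scalar_function_def)
  qed
  obtain f' where f': "(f g has_derivative f') (at B within transverse_forms v)"
    by (rule smooth_scalar_function_has_derivative[OF f g v B])
  have G: "transverse v G"
    using form_derivative(1)[OF g v f' B] by (simp add: G_def transverse_forms_iff)
  \<comment> \<open>The sum lies in the transverse space as the velocity of a curve there, although
    in general neither summand does.\<close>
  have "f' (X + R) = (raise_indices g (X + R) \<bullet> G) / fact CARD('p)"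
    unfolding G_def
    by (rule form_derivative(2)[OF g v f' B vector_derivative_in_subspace[OF \<gamma>' subspace_transverse_forms T \<gamma>(1)]])
  also have "raise_indices g (X + R) \<bullet> G = raise_indices g G \<bullet> X + raise_indices g G \<bullet> R"
    by (simp only: raise_symmetric[OF g, of "X + R"] inner_commute[of _ "raise_indices g G"] inner_add_right)
  also have "raise_indices g G \<bullet> R = 0"
    using B unfolding R_def by (intro inner_rotation_zero transverse_raise[OF g G]) (simp add: transverse_forms_iff)
  finally have "f' (X + R) = (raise_indices g G \<bullet> X) / fact CARD('p)"
    by simp
  moreover have "((\<lambda>t. f g (\<gamma> t)) has_real_derivative f' (X + R)) (at 0)"
    by (rule has_derivative_along_curve[OF _ \<gamma>' T \<gamma>(1)]) (simp_all add: \<open>\<gamma> 0 = B\<close> f')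
  then have "((\<lambda>t. f g (B + t *\<^sub>R X)) has_real_derivative f' (X + R)) (at 0)"
    by (rule has_field_derivative_transform_within_open[OF _ T \<gamma>(2)])
  ultimately have deriv: "((\<lambda>t. f g (B + t *\<^sub>R X)) has_real_derivative (raise_indices g G \<bullet> X) / fact CARD('p)) (at 0)"
    by simp
  have "has_v_variation g e f F v \<delta>v D \<longleftrightarrow> ((\<lambda>t. f g (B + t *\<^sub>R X)) has_real_derivative D) (at 0)"
    by (simp only: has_v_variation_def w_def[symmetric] B_t)
  also have "\<dots> \<longleftrightarrow> D = (raise_indices g G \<bullet> X) / fact CARD('p)"
    using deriv DERIV_unique by blast
  finally show ?thesis
    by (simp only: G_def B_def X_def w_def)
qed

section \<open>From the variation to the wedge product\<close>

lemma contract_last_raise: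
  fixes F :: "('p::finite option, 'd::finite) tensor"
  assumes g: "lorentzian g"
  shows "contract_last (raise_indices g F) (g *v v) = raise_indices g (contract_last F v)"
proof -
  let ?M = "matrix_inv g"
  \<comment> \<open>The covector \<open>g *v v\<close> undoes the raising of the last slot.\<close>
  have M: "(\<Sum>a\<in>UNIV. ?M $ a $ b * (g *v v) $ a) = v $ b" for b
  proof -
    have "(\<Sum>a\<in>UNIV. ?M $ a $ b * (g *v v) $ a) = (transpose ?M *v (g *v v)) $ b"
      unfolding matrix_vector_mult_def[of "transpose ?M"] by (simp add: transpose_def)
    also have "transpose ?M *v (g *v v) = v"
      using g
      by (simp add: transpose_matrix_inv symmetric_lorentzian invertible_lorentzian
          matrix_vector_mul_assoc matrix_inv_left' del: transpose_matrix_vector)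
    finally show ?thesis .
  qed
  have "contract_last (raise_indices g F) (g *v v) $ m = raise_indices g (contract_last F v) $ m" for m
  proof -
    let ?h = "\<lambda>k a b. (\<Prod>s\<in>UNIV. ?M $ m s $ k s) * (F $ case_option b k * (?M $ a $ b * (g *v v) $ a))"
    have "contract_last (raise_indices g F) (g *v v) $ m = (\<Sum>a\<in>UNIV. \<Sum>k\<in>UNIV. \<Sum>b\<in>UNIV. ?h k a b)"
      by (simp add: contract_last_def change_indices_nth sum_fun_option prod_UNIV_option
          sum_distrib_left sum_distrib_right ac_simps)
    also have "\<dots> = (\<Sum>k\<in>UNIV. \<Sum>a\<in>UNIV. \<Sum>b\<in>UNIV. ?h k a b)"
      by (rule sum.swap)
    also have "\<dots> = (\<Sum>k\<in>UNIV. \<Sum>b\<in>UNIV. \<Sum>a\<in>UNIV. ?h k a b)"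
      by (rule sum.cong[OF refl], rule sum.swap)
    also have "\<dots> = raise_indices g (contract_last F v) $ m"
      by (simp only: sum_distrib_left[symmetric] M) (simp add: change_indices_nth contract_last_def)
    finally show ?thesis .
  qed
  then show ?thesis
    by (simp add: vec_eq_iff)
qed

lemma transverse_tensor_product:
  fixes S :: "('s::finite, 'd::finite) tensor" and R :: "('r::finite, 'd) tensor"
  assumes "transverse \<alpha> S" "transverse \<alpha> R"
  shows "transverse \<alpha> (tensor_product S R)"
  unfolding transverse_def
proof (intro allI)
  fix s :: "'s + 'r" and m :: "'s + 'r \<Rightarrow> 'd"
  show "(\<Sum>a\<in>UNIV. tensor_product S R $ m(s := a) * \<alpha> $ a) = 0"
  proof (cases s)
    case (Inl i)
    have "m(Inl i := a) \<circ> Inl = (m \<circ> Inl)(i := a)" "m(Inl i := a) \<circ> Inr = m \<circ> Inr" for a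
      by (auto simp: fun_eq_iff)
    then have "(\<Sum>a\<in>UNIV. tensor_product S R $ m(s := a) * \<alpha> $ a)
      = (\<Sum>a\<in>UNIV. S $ (m \<circ> Inl)(i := a) * \<alpha> $ a) * R $ (m \<circ> Inr)"
      by (simp only: Inl tensor_product_def vec_lambda_beta sum_distrib_right) (simp add: ac_simps)
    then show ?thesis
      by (simp only: transverseD[OF assms(1)] mult_zero_left)
  next
    case (Inr i)
    have "m(Inr i := a) \<circ> Inr = (m \<circ> Inr)(i := a)" "m(Inr i := a) \<circ> Inl = m \<circ> Inl" for a
      by (auto simp: fun_eq_iff)
    then have "(\<Sum>a\<in>UNIV. tensor_product S R $ m(s := a) * \<alpha> $ a)
      = (\<Sum>a\<in>UNIV. R $ (m \<circ> Inr)(i := a) * \<alpha> $ a) * S $ (m \<circ> Inl)"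
      by (simp only: Inr tensor_product_def vec_lambda_beta sum_distrib_right) (simp add: ac_simps)
    then show ?thesis
      by (simp only: transverseD[OF assms(2)] mult_zero_left)
  qed
qed

text \<open>The pointwise core, with the electric part of an arbitrary \<open>F\<close> in the role
  of the derivative of \<open>H\<close>; the shell condition is imposed only afterwards.\<close>

lemma v_independent_at_iff:
  fixes e :: "'p::finite option + 'p option \<Rightarrow> 'd::finite"
  assumes g: "lorentzian g" and e: "bij e" and f: "smooth_scalar_function f"
    and F: "antisymmetric F" and v: "unit_timelike g v"
  shows "(\<forall>\<delta>v. v \<bullet> \<delta>v = 0 \<longrightarrow> has_v_variation g e f F v \<delta>v 0) \<longleftrightarrow>
    antisymmetrize (tensor_product (form_derivative g v (f g) (magnetic g e F v)) (electric F v)) = 0"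
proof -
  note sym = symmetric_lorentzian[OF g] and inv = invertible_lorentzian[OF g]
  define G where "G = form_derivative g v (f g) (magnetic g e F v)"
  define N where "N = levi_civita g e"
  let ?\<alpha> = "g *v v"
  let ?X = "tensor_product (raise_indices g G) (raise_indices g (electric F v))"
  have N: "volume_tensor N"
    using volume_tensor_levi_civita[OF e] inv by (simp add: N_def invertible_det_nz)
  have \<alpha>v: "?\<alpha> \<bullet> v = - 1"
    using v by (simp add: unit_timelike_def inner_commute)
  have B: "magnetic g e F v \<in> transverse_forms v"
    unfolding magnetic_def by (intro contract_last_transverse_forms antisymmetric_dual sym inv e)
  obtain f' where f': "(f g has_derivative f') (at (magnetic g e F v) within transverse_forms v)"
    by (rule smooth_scalar_function_has_derivative[OF f g v B])
  have G: "transverse v G"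
    using form_derivative(1)[OF g v f' B] by (simp add: G_def transverse_forms_iff)
  have E: "transverse v (electric F v)"
    using contract_last_transverse_forms[OF F] by (simp add: electric_def transverse_forms_iff)
  have X: "transverse ?\<alpha> ?X"
    by (intro transverse_tensor_product transverse_raise[OF g] G E)
  have variation: "has_v_variation g e f F v \<delta>v 0 \<longleftrightarrow> N \<bullet> quad ?X (matrix_inv g *v \<delta>v) v = 0"
    if "v \<bullet> \<delta>v = 0" for \<delta>v
  proof -
    let ?w = "matrix_inv g *v \<delta>v"
    have "?\<alpha> \<bullet> ?w = v \<bullet> (g *v ?w)"
      using inner_matrix_vector[of g v ?w] sym by (simp del: transpose_matrix_vector)
    also have "g *v ?w = \<delta>v"
      by (simp add: matrix_vector_mul_assoc matrix_inv_right'[OF inv])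
    finally have w: "?\<alpha> \<bullet> ?w = 0"
      using that by simp
    have "has_v_variation g e f F v \<delta>v 0 \<longleftrightarrow> raise_indices g G \<bullet> magnetic g e F ?w = 0"
      using has_v_variation_iff[OF g e f F v that, of 0] by (auto simp: G_def)
    also have "\<dots> \<longleftrightarrow> N \<bullet> triple (raise_indices g G) ?w (raise_indices g F) = 0"
      by (simp add: inner_magnetic[OF sym inv] N_def)
    also have "\<dots> \<longleftrightarrow> N \<bullet> quad ?X ?w v = 0"
    proof -
      \<comment> \<open>The sign is \<open>\<alpha> \<bullet> v = - 1\<close> in
        \<open>triple_dual_split\<close>.\<close>
      have "- (N \<bullet> triple (raise_indices g G) ?w (raise_indices g F))
        = real CARD('p option) * (N \<bullet> quad ?X ?w v)"
        using triple_dual_split[OF N transverse_raise[OF g G] w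
            antisymmetric_change_indices[OF F, of "matrix_inv g"], where v = v]
        by (simp only: \<alpha>v contract_last_raise[OF g] electric_def mult_minus1)
      then show ?thesis
        by (simp only: neg_equal_0_iff_equal[symmetric, of "N \<bullet> triple _ _ _"] mult_eq_0_iff) simp
    qed
    finally show ?thesis .
  qed
  \<comment> \<open>Raising the index matches the admissible covariant variations with the vectors
    \<open>w\<close> orthogonal to the observer.\<close>
  have "(\<forall>\<delta>v. v \<bullet> \<delta>v = 0 \<longrightarrow> has_v_variation g e f F v \<delta>v 0)
    \<longleftrightarrow> (\<forall>w. ?\<alpha> \<bullet> w = 0 \<longrightarrow> N \<bullet> quad ?X w v = 0)"
  proof (intro iffI allI impI)
    fix w
    assume *: "\<forall>\<delta>v. v \<bullet> \<delta>v = 0 \<longrightarrow> has_v_variation g e f F v \<delta>v 0" and "?\<alpha> \<bullet> w = 0"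
    then have gw: "v \<bullet> (g *v w) = 0"
      using ginner_commute[OF sym, of v w] by (simp add: inner_commute)
    have "matrix_inv g *v (g *v w) = w"
      by (simp add: matrix_vector_mul_assoc matrix_inv_left'[OF inv])
    then show "N \<bullet> quad ?X w v = 0"
      using * gw variation[OF gw] by simp
  next
    fix \<delta>v
    assume *: "\<forall>w. ?\<alpha> \<bullet> w = 0 \<longrightarrow> N \<bullet> quad ?X w v = 0" and \<delta>v: "v \<bullet> \<delta>v = 0"
    have "?\<alpha> \<bullet> (matrix_inv g *v \<delta>v) = v \<bullet> (g *v (matrix_inv g *v \<delta>v))"
      using inner_matrix_vector[of g v] sym by (simp del: transpose_matrix_vector)
    also have "\<dots> = 0"
      using \<delta>v by (simp add: matrix_vector_mul_assoc matrix_inv_right'[OF inv])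
    finally show "has_v_variation g e f F v \<delta>v 0"
      using * variation[OF \<delta>v] by blast
  qed
  also have "\<dots> \<longleftrightarrow> antisymmetrize ?X = 0"
    using antisymmetrize_eq_0_iff[OF N X, of v] \<alpha>v by simp
  also have "\<dots> \<longleftrightarrow> raise_indices g (antisymmetrize (tensor_product G (electric F v))) = 0"
    by (simp only: change_indices_antisymmetrize change_indices_tensor_product)
  also have "\<dots> \<longleftrightarrow> antisymmetrize (tensor_product G (electric F v)) = 0"
    using lower_raise(1)[OF inv, of "antisymmetrize (tensor_product G (electric F v))"] by auto
  finally show ?thesis
    by (simp only: G_def)
qed

theorem mainTheorem11:
  fixes n :: nat
    and g :: "'d::finite metric_tensor"
    and e :: "'p::finite option + 'p option \<Rightarrow> 'd"
    and H Obs :: "'d metric_tensor \<Rightarrow> ('p, 'd) tensor \<Rightarrow> real"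
  assumes "n \<ge> 1" and "CARD('p) = 2 * n" and "CARD('d) = 2 * CARD('p) + 2"
    and "lorentzian g"
    and "bij e"
    and "smooth_scalar_function H"
    and "smooth_scalar_function Obs"
  shows "v_independent_on_shell g e H Obs \<longleftrightarrow> invariant_observable g H Obs"
proof
  note g = \<open>lorentzian g\<close> and e = \<open>bij e\<close>
  note sym = symmetric_lorentzian[OF g] and inv = invertible_lorentzian[OF g]
  {
    assume indep: "v_independent_on_shell g e H Obs"
    show "invariant_observable g H Obs"
      unfolding invariant_observable_def
    proof (intro allI impI ballI)
      fix v and B :: "('p, 'd) tensor"
      assume v: "unit_timelike g v" and B: "B \<in> transverse_forms v"
      obtain H' where H': "(H g has_derivative H') (at B within transverse_forms v)"
        by (rule smooth_scalar_function_has_derivative[OF \<open>smooth_scalar_function H\<close> g v B])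
      \<comment> \<open>The electric part is prescribed to be the derivative of \<open>H\<close> at
        \<open>B\<close>, so this \<open>F\<close> is on shell with the given magnetic part.\<close>
      obtain F where F: "antisymmetric F" "electric F v = form_derivative g v (H g) B"
        "magnetic g e F v = B"
        by (rule exists_electromagnetic[OF g v e form_derivative(1)[OF g v H' B] B])
      have "\<forall>\<delta>v. v \<bullet> \<delta>v = 0 \<longrightarrow> has_v_variation g e Obs F v \<delta>v 0"
        using indep F v by (simp add: v_independent_on_shell_def)
      then show "antisymmetrize (tensor_product (form_derivative g v (Obs g) B) (form_derivative g v (H g) B)) = 0"
        unfolding v_independent_at_iff[OF g e \<open>smooth_scalar_function Obs\<close> F(1) v] F(2,3) .
    qed
  next
    assume inv_obs: "invariant_observable g H Obs"
    show "v_independent_on_shell g e H Obs"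
      unfolding v_independent_on_shell_def
    proof (intro allI impI)
      fix F v \<delta>v
      assume F: "antisymmetric F" and v: "unit_timelike g v"
        and shell: "electric F v = form_derivative g v (H g) (magnetic g e F v)" and \<delta>v: "v \<bullet> \<delta>v = 0"
      have "magnetic g e F v \<in> transverse_forms v"
        unfolding magnetic_def by (intro contract_last_transverse_forms antisymmetric_dual sym inv e)
      then have "antisymmetrize (tensor_product (form_derivative g v (Obs g) (magnetic g e F v)) (electric F v)) = 0"
        using inv_obs v by (simp add: invariant_observable_def shell)
      then show "has_v_variation g e Obs F v \<delta>v 0"
        using v_independent_at_iff[OF g e \<open>smooth_scalar_function Obs\<close> F v] \<delta>v by blast
    qed
  }
qed

end
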